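(* Let $n\ge 2$ be an integer, let $G=\mathrm{BS}(1,n)=\langle a,b\mid b^{-1}ab=a^n\rangle$, and let $E_{lo}^{\mathrm{BS}(1,n)}$ be the conjugation equivalence relation on the space $\mathrm{LO}(G)$ of positive cones of $G$. Then $E_{lo}^{\mathrm{BS}(1,n)}$ is Borel bireducible with $E_0$, i.e. $E_{lo}^{\mathrm{BS}(1,n)}\le_B E_0$ and $E_0\le_B E_{lo}^{\mathrm{BS}(1,n)}$.
   Context: A positive cone of a group $G$ is a subset $P\subseteq G$ with $P\cap P^{-1}=\varnothing$, $PP\subseteq P$ and $P\cup P^{-1}\cup\{id\}=G$; positive cones correspond bijectively to left-orderings of $G$ via $g\prec_P h \iff g^{-1}h\in P$. For countable $G$, $\mathrm{LO}(G)$ is the set of all positive cones of $G$, a closed subspace of $2^G$ and hence a Polish space. $G$ acts on $\mathrm{LO}(G)$ by conjugation, $g(P)=P^{g^{-1}}=gPg^{-1}$, where $P^g=\{g^{-1}pg: p\in P\}$. The relation $E_{lo}^G$ on $\mathrm{LO}(G)$ is defined by $P\mathrel{E_{lo}^G}Q$ if and only if there is $g\in G$ with $g(P)=Q$. $E_0$ is the equivalence relation of eventual equality on $2^\omega$: $x\mathrel{E_0}y$ if and only if there is $m$ such that $x(k)=y(k)$ for all $k>m$. For equivalence relations $E,F$ on Polish spaces $X,Y$, $E\le_B F$ means that there is a Borel map $f:X\to Y$ with $x\mathrel{E}x' \iff f(x)\mathrel{F}f(x')$ for all $x,x'\in X$. *)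

theory Defs
  imports "HOL-Analysis.Analysis" "HOL-Algebra.Coset"
begin

section \<open>Groups given by generators and relations\<close>

text \<open>Words over the generators of type \<open>'s\<close>; \<open>(s, True)\<close> stands for \<open>s\<close> and \<open>(s, False)\<close> for
  its inverse. A pair \<open>(l, r)\<close> in \<open>R\<close> stands for the relation \<open>l = r\<close>.\<close>

type_synonym 's word = "('s \<times> bool) list"

inductive pres_eq :: "('s word \<times> 's word) set \<Rightarrow> 's word \<Rightarrow> 's word \<Rightarrow> bool"
  for R where
  refl: "pres_eq R w w"
| sym: "pres_eq R v w \<Longrightarrow> pres_eq R w v"
| trans: "pres_eq R u v \<Longrightarrow> pres_eq R v w \<Longrightarrow> pres_eq R u w"
| cancel: "pres_eq R (u @ [(s, e), (s, \<not> e)] @ v) (u @ v)"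
| rel: "(l, r) \<in> R \<Longrightarrow> pres_eq R (u @ l @ v) (u @ r @ v)"

definition pres_class :: "('s word \<times> 's word) set \<Rightarrow> 's word \<Rightarrow> 's word set" where
  "pres_class R w = {v. pres_eq R w v}"

definition presented_group :: "('s word \<times> 's word) set \<Rightarrow> 's word set monoid" where
  "presented_group R =
     \<lparr>carrier = range (pres_class R),
      mult = (\<lambda>X Y. \<Union>x\<in>X. \<Union>y\<in>Y. pres_class R (x @ y)),
      one = pres_class R []\<rparr>"

lemma pres_eq_append:
  assumes "pres_eq R u u'" "pres_eq R v v'"
  shows "pres_eq R (u @ v) (u' @ v')"
proof -
  have left: "pres_eq R (u @ t) (u' @ t)" for t
    using assms(1)
  proof (induction rule: pres_eq.induct)
    case (cancel u s e v)
    show ?case using pres_eq.cancel[of R u s e "v @ t"] by simp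
  next
    case (rel l r u v)
    show ?case using pres_eq.rel[OF rel, of u "v @ t"] by simp
  next
    case (sym v w)
    show ?case by (rule pres_eq.sym[OF sym.IH])
  next
    case (trans u v w)
    show ?case by (rule pres_eq.trans[OF trans.IH])
  qed (rule pres_eq.refl)
  have right: "pres_eq R (t @ v) (t @ v')" for t
    using assms(2)
  proof (induction rule: pres_eq.induct)
    case (cancel u s e v)
    show ?case using pres_eq.cancel[of R "t @ u" s e v] by simp
  next
    case (rel l r u v)
    show ?case using pres_eq.rel[OF rel, of "t @ u" v] by simp
  next
    case (sym v w)
    show ?case by (rule pres_eq.sym[OF sym.IH])
  next
    case (trans u v w)
    show ?case by (rule pres_eq.trans[OF trans.IH])
  qed (rule pres_eq.refl)
  show ?thesis
    by (rule pres_eq.trans[OF left right])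
qed

lemma pres_class_eq_iff: "pres_class R v = pres_class R w \<longleftrightarrow> pres_eq R v w"
  unfolding pres_class_def
  by (metis (mono_tags, lifting) Collect_cong mem_Collect_eq pres_eq.refl pres_eq.sym pres_eq.trans)

lemma presented_group_mult:
  "pres_class R v \<otimes>\<^bsub>presented_group R\<^esub> pres_class R w = pres_class R (v @ w)"
proof -
  have "pres_class R (x @ y) = pres_class R (v @ w)"
    if "x \<in> pres_class R v" "y \<in> pres_class R w" for x y
  proof -
    have "pres_eq R (v @ w) (x @ y)"
      using that by (intro pres_eq_append) (simp_all add: pres_class_def)
    then show ?thesis by (simp add: pres_class_eq_iff pres_eq.sym)
  qed
  then have "(\<Union>x\<in>pres_class R v. \<Union>y\<in>pres_class R w. pres_class R (x @ y))
      = (\<Union>x\<in>pres_class R v. \<Union>y\<in>pres_class R w. pres_class R (v @ w))"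
    by simp
  moreover have "v \<in> pres_class R v" "w \<in> pres_class R w"
    by (simp_all add: pres_class_def pres_eq.refl)
  then have "pres_class R v \<noteq> {}" "pres_class R w \<noteq> {}"
    by blast+
  ultimately show ?thesis
    by (simp add: presented_group_def)
qed

lemma group_presented_group: "group (presented_group R)"
proof (rule groupI)
  let ?i = "\<lambda>w. rev (map (\<lambda>(s, e). (s, \<not> e)) w)"
  have inv: "pres_eq R (?i w @ w) []" for w
  proof (induction w)
    case Nil
    show ?case by (simp add: pres_eq.refl)
  next
    case (Cons x w)
    obtain s e where x: "x = (s, e)" by (cases x)
    have "pres_eq R (?i w @ [(s, \<not> e), (s, \<not> \<not> e)] @ w) (?i w @ w)"
      by (rule pres_eq.cancel)
    then show ?case
      using pres_eq.trans[OF _ Cons.IH] by (simp add: x)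
  qed
  fix x assume "x \<in> carrier (presented_group R)"
  then obtain w where "x = pres_class R w"
    by (auto simp: presented_group_def)
  then have "pres_class R (?i w) \<otimes>\<^bsub>presented_group R\<^esub> x = \<one>\<^bsub>presented_group R\<^esub>"
    using inv[of w] by (simp only: presented_group_mult) (simp add: presented_group_def pres_class_eq_iff)
  then show "\<exists>y\<in>carrier (presented_group R). y \<otimes>\<^bsub>presented_group R\<^esub> x = \<one>\<^bsub>presented_group R\<^esub>"
    by (auto simp: presented_group_def)
next
  have c: "carrier (presented_group R) = range (pres_class R)"
    and o: "\<one>\<^bsub>presented_group R\<^esub> = pres_class R []"
    by (simp_all add: presented_group_def)
  show "x \<otimes>\<^bsub>presented_group R\<^esub> y \<in> carrier (presented_group R)"
    if "x \<in> carrier (presented_group R)" "y \<in> carrier (presented_group R)" for x y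
    using that unfolding c by (auto simp: presented_group_mult)
  show "\<one>\<^bsub>presented_group R\<^esub> \<in> carrier (presented_group R)"
    by (simp add: c o)
  show "x \<otimes>\<^bsub>presented_group R\<^esub> y \<otimes>\<^bsub>presented_group R\<^esub> z
      = x \<otimes>\<^bsub>presented_group R\<^esub> (y \<otimes>\<^bsub>presented_group R\<^esub> z)"
    if "x \<in> carrier (presented_group R)" "y \<in> carrier (presented_group R)"
      "z \<in> carrier (presented_group R)" for x y z
    using that unfolding c by (auto simp: presented_group_mult)
  show "\<one>\<^bsub>presented_group R\<^esub> \<otimes>\<^bsub>presented_group R\<^esub> x = x"
    if "x \<in> carrier (presented_group R)" for x
    using that unfolding c o by (auto simp: presented_group_mult)
qed

datatype bs_gen = Gen_a | Gen_b

definition BS1 :: "nat \<Rightarrow> bs_gen word set monoid" where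
  "BS1 n = presented_group
     {([(Gen_b, False), (Gen_a, True), (Gen_b, True)], replicate n (Gen_a, True))}"


section \<open>Positive cones\<close>

definition positive_cone :: "('a, 'm) monoid_scheme \<Rightarrow> 'a set \<Rightarrow> bool" where
  "positive_cone G P \<longleftrightarrow>
     P \<subseteq> carrier G \<and>
     P \<inter> set_inv\<^bsub>G\<^esub> P = {} \<and>
     P <#>\<^bsub>G\<^esub> P \<subseteq> P \<and>
     P \<union> set_inv\<^bsub>G\<^esub> P \<union> {\<one>\<^bsub>G\<^esub>} = carrier G"

definition LO :: "('a, 'm) monoid_scheme \<Rightarrow> 'a set set" where
  "LO G = {P. positive_cone G P}"

definition E_lo :: "('a, 'm) monoid_scheme \<Rightarrow> 'a set rel" where
  "E_lo G = {(P, Q). P \<in> LO G \<and> Q \<in> LO G \<and>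
     (\<exists>g\<in>carrier G. g <#\<^bsub>G\<^esub> P #>\<^bsub>G\<^esub> (inv\<^bsub>G\<^esub> g) = Q)}"


section \<open>Topologies and Borel reducibility\<close>

definition power_two :: "'i set \<Rightarrow> ('i \<Rightarrow> bool) topology" where
  "power_two I = product_topology (\<lambda>_. discrete_topology UNIV) I"

text \<open>The topology of \<open>2\<^sup>I\<close> on the subsets of \<open>I\<close>, transported along indicator functions.\<close>

definition powerset_topology :: "'i set \<Rightarrow> 'i set topology" where
  "powerset_topology I =
     pullback_topology (Pow I) (\<lambda>A. \<lambda>i\<in>I. i \<in> A) (power_two I)"

definition LO_topology :: "('a, 'm) monoid_scheme \<Rightarrow> 'a set topology" where
  "LO_topology G = subtopology (powerset_topology (carrier G)) (LO G)"

definition E0 :: "(nat \<Rightarrow> bool) rel" where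
  "E0 = {(x, y). \<exists>m. \<forall>k>m. x k = y k}"

definition borel_of :: "'a topology \<Rightarrow> 'a measure" where
  "borel_of X = sigma (topspace X) {U. openin X U}"

definition borel_reducible :: "'a topology \<Rightarrow> 'a rel \<Rightarrow> 'b topology \<Rightarrow> 'b rel \<Rightarrow> bool" where
  "borel_reducible X E Y F \<longleftrightarrow>
     (\<exists>f \<in> borel_of X \<rightarrow>\<^sub>M borel_of Y.
        \<forall>x\<in>topspace X. \<forall>x'\<in>topspace X. (x, x') \<in> E \<longleftrightarrow> (f x, f x') \<in> F)"

lemma topspace_power_two_UNIV: "topspace (power_two UNIV) = UNIV"
  by (simp add: power_two_def)

lemma topspace_LO_topology: "topspace (LO_topology G) = LO G"
  by (auto simp: LO_topology_def powerset_topology_def power_two_def topspace_pullback_topology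
      LO_def positive_cone_def)

end

theory Submission
  imports Defs
begin

text \<open>
  The element \<open>g\<close> of \<open>BS(1,n)\<close> acts on the real line by an affine map
  \<open>t \<mapsto> n^(-k) t + x\<close> with \<open>k\<close> an integer and \<open>x \<in> \<int>[1/n]\<close>: the generator \<open>a\<close> is
  \<open>t \<mapsto> t + 1\<close> and \<open>b\<close> is \<open>t \<mapsto> t / n\<close>. Every word reduces to the form \<open>b^i a^m b^(-j)\<close>, whose affine map
  determines the element, so \<open>BS(1,n)\<close> is exactly the group of all these maps
  (\<open>BS1_affine_group\<close>). The locale \<open>affine_group\<close> axiomatises this description, and everything about
  left-orders is proved there.

  Orders. Replacing a cone \<open>P\<close> by its inverse, one may assume that the translation \<open>a\<close> is positive,
  and then a translation is positive iff it moves points to the right. For a contraction \<open>g\<close> (that is,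
  \<open>k > 0\<close>), write \<open>fix g\<close> for its fixed point. If \<open>h\<close> is a positive contraction of slope
  \<open>1/n\<close> and \<open>fix h < fix g\<close>, then \<open>g\<close> is the product of a positive translation and the power of \<open>h\<close> that has
  the slope of \<open>g\<close>, so \<open>g\<close> is positive. Hence the positive contractions of a cone are those whose
  fixed point lies above a cut in the extended real line, with one additional bit deciding all contractions that fix the cut itself
  (\<open>cone_mem_iff\<close>). The sign of \<open>a\<close>, the cut and this bit determine the cone
  (\<open>cone_determined\<close>); conjugation by \<open>g\<close> moves the cut by the affine map of \<open>g\<close> and leaves the two bits
  alone. So two cones are conjugate iff their bits agree and their cuts lie in one orbit
  of the affine group (\<open>conjugate_iff\<close>).

  Digits. Two reals lie in one orbit iff their sequences of base-\<open>n\<close> digits agree up to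
  a shift and finitely many terms: multiplication by \<open>n\<close> shifts digits, and adding an element of
  \<open>\<int>[1/n]\<close> changes only finitely many of them (\<open>digits_tail_eq_iff\<close>). Tail equivalence, in turn, is
  Borel reducible to \<open>E\<^sub>0\<close>: in each tail class there is a canonical infinite word all of whose
  prefixes recur in the sequence; the first occurrences of longer and longer prefixes are markers that
  tail equivalent sequences eventually place at corresponding positions, and the words between
  successive markers form a sequence whose germ at infinity is a complete invariant
  (\<open>tail_code_complete\<close>, \<open>tail_code_sound\<close>). This gives \<open>E_lo \<le> E\<^sub>0\<close>.

  Conversely, a bit sequence \<open>x\<close> is sent to the real whose digits are 1 exactly at positions
  \<open>2^(2k + 1 + x k)\<close>. These positions are so sparse that two such digit sequences are tail equivalent
  only without a shift, hence only if the bit sequences are \<open>E\<^sub>0\<close>-equivalent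
  (\<open>spread_tail_eq\<close>). The set of all \<open>g\<close> that move a given real \<open>t\<close> to the right, or fix it and contract,
  is a positive cone whose conjugates are the cones of the points of the orbit of \<open>t\<close>
  (\<open>point_cone_conj\<close>), and this gives \<open>E\<^sub>0 \<le> E_lo\<close>.
\<close>

section \<open>Tail equivalence of sequences over a finite alphabet\<close>

definition tail_eq :: "(nat \<Rightarrow> 'a) \<Rightarrow> (nat \<Rightarrow> 'a) \<Rightarrow> bool" where
  "tail_eq d d' \<longleftrightarrow> (\<exists>k l. \<forall>i. d (k + i) = d' (l + i))"

definition occurs :: "(nat \<Rightarrow> 'a) \<Rightarrow> 'a list \<Rightarrow> nat \<Rightarrow> bool" where
  "occurs d w p \<longleftrightarrow> (\<forall>i<length w. d (p + i) = w ! i)"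

text \<open>Occurrence at arbitrarily late positions depends only on the tail of the sequence.\<close>

definition recurs :: "(nat \<Rightarrow> 'a) \<Rightarrow> 'a list \<Rightarrow> bool" where
  "recurs d w \<longleftrightarrow> (\<forall>q. \<exists>p\<ge>q. occurs d w p)"

text \<open>The prefixes of the canonical word of a tail class: the word is extended greedily by the least
  letter that keeps it recurring, so each prefix recurs and depends only on the tail class.\<close>

primrec rec_word :: "(nat \<Rightarrow> nat) \<Rightarrow> nat \<Rightarrow> nat list" where
  "rec_word d 0 = []"
| "rec_word d (Suc m) = rec_word d m @ [LEAST c. recurs d (rec_word d m @ [c])]"

definition rec_limit :: "(nat \<Rightarrow> nat) \<Rightarrow> nat \<Rightarrow> nat" where
  "rec_limit d i = rec_word d (Suc i) ! i"

definition first_occ :: "(nat \<Rightarrow> nat) \<Rightarrow> nat \<Rightarrow> nat" where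
  "first_occ d m = (LEAST p. occurs d (rec_word d m) p)"

text \<open>If a tail of \<open>d\<close> is also a tail of its canonical word, the first occurrences may stay bounded, but then
  the canonical word itself represents the tail class and its prefixes serve as the code.\<close>

definition tail_code :: "(nat \<Rightarrow> nat) \<Rightarrow> nat \<Rightarrow> bool \<times> nat list" where
  "tail_code d m = (if tail_eq d (rec_limit d) then (True, rec_word d m)
     else (False, map d [first_occ d m..<first_occ d (Suc m)]))"

lemma tail_eq_sym: "tail_eq d d' \<Longrightarrow> tail_eq d' d"
  unfolding tail_eq_def by metis

lemma tail_eq_trans:
  assumes "tail_eq d d'" "tail_eq d' d''"
  shows "tail_eq d d''"
proof -
  obtain k l k' l' where 1: "\<And>i. d (k + i) = d' (l + i)" and 2: "\<And>i. d' (k' + i) = d'' (l' + i)"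
    using assms unfolding tail_eq_def by metis
  have "d ((k + k') + i) = d'' ((l' + l) + i)" for i
    using 1[of "k' + i"] 2[of "l + i"] by (simp add: ac_simps)
  then show ?thesis unfolding tail_eq_def by blast
qed

lemma occurs_snoc: "occurs d (w @ [c]) p \<longleftrightarrow> occurs d w p \<and> d (p + length w) = c"
  by (auto simp: occurs_def nth_append less_Suc_eq)

text \<open>Pigeonhole on the finitely many letters that can follow an occurrence of the word.\<close>

lemma recurs_extend:
  assumes bd: "\<forall>i. d i < (n::nat)" and "recurs d w"
  shows "\<exists>c. recurs d (w @ [c])"
proof (rule ccontr)
  assume "\<not> ?thesis"
  then have "\<forall>c. \<exists>q. \<forall>p\<ge>q. \<not> occurs d (w @ [c]) p" by (auto simp: recurs_def)
  then obtain q where q: "\<And>c p. p \<ge> q c \<Longrightarrow> \<not> occurs d (w @ [c]) p" by metis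
  obtain p where p: "p \<ge> (\<Sum>c<n. q c)" "occurs d w p"
    using assms(2) by (auto simp: recurs_def)
  let ?c = "d (p + length w)"
  have "q ?c \<le> (\<Sum>c<n. q c)" by (rule member_le_sum) (use bd in auto)
  then have "\<not> occurs d (w @ [?c]) p" using q p(1) by (meson le_trans)
  moreover have "occurs d (w @ [?c]) p"
    using p(2) by (simp add: occurs_snoc)
  ultimately show False by blast
qed

lemma length_rec_word [simp]: "length (rec_word d m) = m"
  by (induction m) auto

lemma recurs_rec_word:
  assumes bd: "\<forall>i. d i < (n::nat)"
  shows "recurs d (rec_word d m)"
proof (induction m)
  case 0
  show ?case by (auto simp: recurs_def occurs_def)
next
  case (Suc m)
  show ?case using LeastI_ex[OF recurs_extend[OF bd Suc]] by simp
qed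

lemma rec_word_nth: "i < m \<Longrightarrow> rec_word d m ! i = rec_limit d i"
  by (induction m) (auto simp: rec_limit_def nth_append less_Suc_eq)

lemma occurs_rec_word: "occurs d (rec_word d' m) p \<longleftrightarrow> (\<forall>i<m. d (p + i) = rec_limit d' i)"
  by (auto simp: occurs_def rec_word_nth)

lemma recurs_tail_eq:
  assumes "tail_eq d d'"
  shows "recurs d w = recurs d' w"
proof -
  have *: "recurs e' w" if e: "tail_eq e e'" and r: "recurs e w" for e e'
    unfolding recurs_def
  proof
    fix q
    obtain k l where kl: "\<And>i. e (k + i) = e' (l + i)" using e unfolding tail_eq_def by blast
    obtain p where p: "p \<ge> k + q" "occurs e w p" using r unfolding recurs_def by blast
    have "e (p + i) = e' (l + (p - k) + i)" for i
      using kl[of "p - k + i"] p(1) by (simp add: ac_simps)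
    then have "occurs e' w (l + (p - k))" using p(2) by (simp add: occurs_def)
    then show "\<exists>p\<ge>q. occurs e' w p" using p(1) by (intro exI[of _ "l + (p - k)"]) auto
  qed
  show ?thesis using *[OF assms] *[OF tail_eq_sym[OF assms]] by blast
qed

lemma rec_word_tail_eq: "tail_eq d d' \<Longrightarrow> rec_word d m = rec_word d' m"
  by (induction m) (simp_all add: recurs_tail_eq)

lemma rec_limit_tail_eq: "tail_eq d d' \<Longrightarrow> rec_limit d = rec_limit d'"
  by (simp add: fun_eq_iff rec_limit_def rec_word_tail_eq del: rec_word.simps)

lemma first_occ_occurs:
  assumes bd: "\<forall>i. d i < (n::nat)"
  shows "occurs d (rec_word d m) (first_occ d m)"
  unfolding first_occ_def
  by (rule LeastI_ex) (use recurs_rec_word[OF bd, of m] in \<open>auto simp: recurs_def\<close>)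

lemma first_occ_mono:
  fixes m m' :: nat
  assumes bd: "\<forall>i. d i < (n::nat)" and "m \<le> m'"
  shows "first_occ d m \<le> first_occ d m'"
proof -
  have "occurs d (rec_word d m) (first_occ d m')"
    using first_occ_occurs[OF bd, of m'] assms(2) by (auto simp: occurs_rec_word)
  then show ?thesis unfolding first_occ_def[of d m] by (rule Least_le)
qed

text \<open>If infinitely many prefixes had the same first occurrence, the sequence would coincide with the
  canonical word from there on.\<close>

lemma first_occ_unbounded:
  assumes bd: "\<forall>i. d i < (n::nat)" and "\<not> tail_eq d (rec_limit d)"
  shows "\<exists>m0. \<forall>m\<ge>m0. first_occ d m \<ge> B"
proof (rule ccontr)
  assume "\<not> ?thesis"
  then have "\<forall>m. first_occ d m \<in> {..B}"
    by (metis first_occ_mono[OF bd] atMost_iff le_trans nat_le_linear)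
  then have "range (first_occ d) \<subseteq> {..B}" by blast
  then have "finite (range (first_occ d))" by (rule finite_subset) simp
  then obtain m where m: "infinite {m'. first_occ d m' = first_occ d m}"
    using pigeonhole_infinite[of UNIV "first_occ d"] by auto
  have "d (first_occ d m + i) = rec_limit d (0 + i)" for i
  proof -
    obtain m' where "m' > i" "first_occ d m' = first_occ d m"
      using m unfolding infinite_nat_iff_unbounded by auto
    then show ?thesis using first_occ_occurs[OF bd, of m'] by (auto simp: occurs_rec_word)
  qed
  then have "tail_eq d (rec_limit d)" unfolding tail_eq_def by blast
  then show False using assms(2) by blast
qed

text \<open>Once the markers have passed the positions from which the two sequences agree, a first occurrence in
  one sequence corresponds to a first occurrence in the other, and the words between markers coincide.\<close>

lemma tail_code_complete:
  assumes bd: "\<forall>i. d i < (n::nat)" "\<forall>i. d' i < n" and te: "tail_eq d d'"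
  shows "\<exists>m0. \<forall>m\<ge>m0. tail_code d m = tail_code d' m"
proof -
  note rw = rec_word_tail_eq[OF te] rec_limit_tail_eq[OF te]
  have hit: "tail_eq d (rec_limit d) = tail_eq d' (rec_limit d')"
    unfolding rw using te tail_eq_sym tail_eq_trans by metis
  show ?thesis
  proof (cases "tail_eq d (rec_limit d)")
    case True
    then show ?thesis using hit rw by (simp add: tail_code_def)
  next
    case False
    obtain k l where kl: "\<And>i. d (k + i) = d' (l + i)" using te unfolding tail_eq_def by blast
    obtain m1 where m1: "\<And>m. m \<ge> m1 \<Longrightarrow> first_occ d m \<ge> k"
      using first_occ_unbounded[OF bd(1) False] by blast
    obtain m2 where m2: "\<And>m. m \<ge> m2 \<Longrightarrow> first_occ d' m \<ge> l"
      using first_occ_unbounded[OF bd(2)] False hit by blast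
    have occ: "occurs d w (k + i) = occurs d' w (l + i)" for w i
      using kl by (auto simp: occurs_def add.assoc)
    have first: "first_occ d m - k = first_occ d' m - l" if m: "m \<ge> max m1 m2" for m
    proof -
      have 1: "first_occ d m \<ge> k" "first_occ d' m \<ge> l" using m m1 m2 by auto
      have "first_occ d m \<le> k + (first_occ d' m - l)"
        unfolding first_occ_def[of d] rw
        by (rule Least_le, unfold occ) (use 1 first_occ_occurs[OF bd(2), of m] in auto)
      moreover have "first_occ d' m \<le> l + (first_occ d m - k)"
        unfolding first_occ_def[of d'] rw[symmetric]
        by (rule Least_le, unfold occ[symmetric]) (use 1 first_occ_occurs[OF bd(1), of m] in auto)
      ultimately show ?thesis using 1 by linarith
    qed
    have seg: "map e [k + a..<k + b] = map (\<lambda>i. e (k + i)) [a..<b]" for a b k and e :: "nat \<Rightarrow> nat"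
      by (rule nth_equalityI) (auto simp: ac_simps)
    have "tail_code d m = tail_code d' m" if m: "m \<ge> max m1 m2" for m
    proof -
      have m': "Suc m \<ge> max m1 m2" using m by simp
      define p q where "p = first_occ d m - k" and "q = first_occ d (Suc m) - k"
      have "first_occ d m = k + p" "first_occ d' m = l + p"
        "first_occ d (Suc m) = k + q" "first_occ d' (Suc m) = l + q"
        using first[OF m] first[OF m'] m m' m1[of m] m1[of "Suc m"] m2[of m] m2[of "Suc m"]
        unfolding p_def q_def by auto
      then have "map d [first_occ d m..<first_occ d (Suc m)]
          = map d' [first_occ d' m..<first_occ d' (Suc m)]"
        by (simp only: seg kl)
      then show ?thesis using False hit by (simp add: tail_code_def)
    qed
    then show ?thesis by blast
  qed
qed

text \<open>Concatenating the words between successive markers recovers a whole tail of the sequence, because the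
  markers tend to infinity.\<close>

lemma tail_code_sound:
  assumes bd: "\<forall>i. d i < (n::nat)" "\<forall>i. d' i < n"
    and eq: "\<And>m. m \<ge> m0 \<Longrightarrow> tail_code d m = tail_code d' m"
  shows "tail_eq d d'"
proof (cases "tail_eq d (rec_limit d)")
  case True
  have hit: "tail_eq d' (rec_limit d')"
    using eq[of m0] True by (auto simp: tail_code_def split: if_splits)
  have w: "rec_word d m = rec_word d' m" if "m \<ge> m0" for m
    using eq[OF that] True hit by (auto simp: tail_code_def)
  have "rec_limit d i = rec_limit d' i" for i
    using w[of "max m0 (Suc i)"] rec_word_nth[of i "max m0 (Suc i)" d]
      rec_word_nth[of i "max m0 (Suc i)" d'] by (simp add: less_max_iff_disj)
  then have "rec_limit d = rec_limit d'" by blast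
  then show ?thesis using True hit tail_eq_trans tail_eq_sym by metis
next
  case False
  have hit: "\<not> tail_eq d' (rec_limit d')"
    using eq[of m0] False by (auto simp: tail_code_def split: if_splits)
  have seg: "map d [first_occ d m..<first_occ d (Suc m)] = map d' [first_occ d' m..<first_occ d' (Suc m)]"
    if "m \<ge> m0" for m
    using eq[OF that] False hit by (auto simp: tail_code_def)
  have upt: "[first_occ e m0..<first_occ e (Suc (m0 + j))]
      = [first_occ e m0..<first_occ e (m0 + j)] @ [first_occ e (m0 + j)..<first_occ e (Suc (m0 + j))]"
    if bd: "\<forall>i. e i < n" for e j
    using upt_add_eq_append[of "first_occ e m0" "first_occ e (m0 + j)" "first_occ e (Suc (m0 + j)) - first_occ e (m0 + j)"]
      first_occ_mono[OF bd, of m0 "m0 + j"] first_occ_mono[OF bd, of "m0 + j" "Suc (m0 + j)"] by simp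
  have long: "map d [first_occ d m0..<first_occ d (m0 + j)] = map d' [first_occ d' m0..<first_occ d' (m0 + j)]" for j
  proof (induction j)
    case (Suc j)
    then show ?case
      using upt[OF bd(1), of j] upt[OF bd(2), of j] seg[of "m0 + j"] by simp
  qed simp
  have "d (first_occ d m0 + i) = d' (first_occ d' m0 + i)" for i
  proof -
    obtain m1 where "\<And>m. m \<ge> m1 \<Longrightarrow> first_occ d m \<ge> Suc (first_occ d m0 + i)"
      using first_occ_unbounded[OF bd(1) False] by blast
    then have b: "first_occ d (m0 + m1) > first_occ d m0 + i" by (metis Suc_le_eq le_add2)
    then have b': "first_occ d' (m0 + m1) > first_occ d' m0 + i"
      using arg_cong[OF long[of m1], of length] by simp
    show ?thesis
      using arg_cong[OF long[of m1], of "\<lambda>l. l ! i"] b b' by simp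
  qed
  then show ?thesis unfolding tail_eq_def by blast
qed

section \<open>Base-n digits and affine equivalence of reals\<close>

definition digits :: "nat \<Rightarrow> real \<Rightarrow> nat \<Rightarrow> nat" where
  "digits n x j = nat (\<lfloor>real n ^ j * x\<rfloor> mod int n)"

lemma digits_less: "n \<ge> 2 \<Longrightarrow> digits n x j < n"
  by (simp add: digits_def nat_less_iff)

lemma digits_shift: "digits n (real n ^ k * x) j = digits n x (j + k)"
  by (simp add: digits_def power_add mult.assoc)

text \<open>After scaling by a power of \<open>n\<close> larger than the denominator, the added number becomes an integer
  divisible by \<open>n\<close>.\<close>

lemma digits_add:
  assumes n: "n \<ge> 2"
  shows "digits n (x + of_int m / real n ^ i) (Suc i + j) = digits n x (Suc i + j)"
proof -
  have "real n ^ (Suc i + j) * (x + of_int m / real n ^ i)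
      = real n ^ (Suc i + j) * x + of_int (int n * (m * int n ^ j))"
    using n by (simp add: power_add field_simps)
  then have "\<lfloor>real n ^ (Suc i + j) * (x + of_int m / real n ^ i)\<rfloor>
      = \<lfloor>real n ^ (Suc i + j) * x\<rfloor> + int n * (m * int n ^ j)"
    by (simp only: floor_add_int)
  then show ?thesis unfolding digits_def by simp
qed

text \<open>The difference of the integer parts of \<open>n^j y\<close> and \<open>n^j x\<close> is multiplied by exactly \<open>n\<close> at each step
  where the digits agree, so after division by \<open>n^j\<close> it is constant; its limit is \<open>y - x\<close>.\<close>

lemma digits_eq_imp:
  assumes n: "n \<ge> 2" and eq: "\<And>j. j \<ge> i \<Longrightarrow> digits n x j = digits n y j"
  shows "\<exists>m::int. y = x + of_int m / real n ^ i"
proof -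
  define D where "D j = \<lfloor>real n ^ j * y\<rfloor> - \<lfloor>real n ^ j * x\<rfloor>" for j
  have step: "\<lfloor>real n ^ Suc j * z\<rfloor> = int n * \<lfloor>real n ^ j * z\<rfloor> + int (digits n z (Suc j))" for j z
  proof -
    have "\<lfloor>real n ^ Suc j * z\<rfloor> div int n = \<lfloor>real n ^ Suc j * z / real_of_int (int n)\<rfloor>"
      using n by (metis floor_divide_real_eq_div of_nat_0_le_iff)
    also have "real n ^ Suc j * z / real_of_int (int n) = real n ^ j * z"
      using n by simp
    finally have "\<lfloor>real n ^ Suc j * z\<rfloor> = int n * \<lfloor>real n ^ j * z\<rfloor> + \<lfloor>real n ^ Suc j * z\<rfloor> mod int n"
      by (metis mult_div_mod_eq)
    then show ?thesis using n by (simp add: digits_def)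
  qed
  have D: "D (i + j) = int n ^ j * D i" for j
  proof (induction j)
    case (Suc j)
    have "D (Suc (i + j)) = int n * D (i + j)"
      using eq[of "Suc (i + j)"] unfolding D_def step by (simp add: algebra_simps)
    then show ?case using Suc by simp
  qed simp
  have "(\<lambda>j. real_of_int (D (i + j)) / real n ^ (i + j)) \<longlonglongrightarrow> y - x"
  proof -
    have fl: "(\<lambda>j. of_int \<lfloor>real n ^ j * z\<rfloor> / real n ^ j) \<longlonglongrightarrow> z" for z
    proof (rule real_tendsto_sandwich)
      have "(\<lambda>j. (1 / real n) ^ j) \<longlonglongrightarrow> 0"
        by (rule LIMSEQ_power_zero) (use n in simp)
      then show "(\<lambda>j. z - (1 / real n) ^ j) \<longlonglongrightarrow> z"
        using tendsto_diff[OF tendsto_const[of z]] by fastforce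
      show "\<forall>\<^sub>F j in sequentially. z - (1 / real n) ^ j \<le> of_int \<lfloor>real n ^ j * z\<rfloor> / real n ^ j"
      proof (rule always_eventually, rule allI)
        fix j
        have "real n ^ j * z - 1 \<le> of_int \<lfloor>real n ^ j * z\<rfloor>" by linarith
        then have "(real n ^ j * z - 1) / real n ^ j \<le> of_int \<lfloor>real n ^ j * z\<rfloor> / real n ^ j"
          by (rule divide_right_mono) simp
        then show "z - (1 / real n) ^ j \<le> of_int \<lfloor>real n ^ j * z\<rfloor> / real n ^ j"
          using n by (simp add: diff_divide_distrib power_divide)
      qed
      show "\<forall>\<^sub>F j in sequentially. of_int \<lfloor>real n ^ j * z\<rfloor> / real n ^ j \<le> z"
        using n by (intro always_eventually allI) (simp add: divide_le_eq mult.commute)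
    qed (rule tendsto_const)
    have "(\<lambda>j. of_int \<lfloor>real n ^ j * y\<rfloor> / real n ^ j - of_int \<lfloor>real n ^ j * x\<rfloor> / real n ^ j) \<longlonglongrightarrow> y - x"
      by (intro tendsto_diff fl)
    then have "(\<lambda>j. of_int (D j) / real n ^ j) \<longlonglongrightarrow> y - x"
      by (simp add: D_def diff_divide_distrib)
    then show ?thesis using LIMSEQ_ignore_initial_segment[of _ _ i] by (simp add: add.commute)
  qed
  moreover have "real_of_int (D (i + j)) / real n ^ (i + j) = of_int (D i) / real n ^ i" for j
    using n by (simp add: D power_add field_simps)
  ultimately have "(\<lambda>j::nat. of_int (D i) / real n ^ i) \<longlonglongrightarrow> y - x" by simp
  then have "y - x = of_int (D i) / real n ^ i"
    using LIMSEQ_unique[OF tendsto_const] by metis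
  then have "y = x + of_int (D i) / real n ^ i" by simp
  then show ?thesis by blast
qed

theorem digits_tail_eq_iff:
  assumes n: "n \<ge> 2"
  shows "tail_eq (digits n x) (digits n y) \<longleftrightarrow>
    (\<exists>(k::int) (m::int) (i::nat). y = of_int m / real n ^ i + real n powi (- k) * x)"
proof
  assume "tail_eq (digits n x) (digits n y)"
  then obtain k l where kl: "\<And>i. digits n x (k + i) = digits n y (l + i)"
    unfolding tail_eq_def by blast
  have "digits n (real n ^ k * x) j = digits n (real n ^ l * y) j" for j
    using kl[of j] by (simp add: digits_shift add.commute)
  then obtain m :: int where "real n ^ l * y = real n ^ k * x + of_int m / real n ^ 0"
    using digits_eq_imp[OF n, of 0] by blast
  then have "y = of_int m / real n ^ l + real n ^ k / real n ^ l * x"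
    using n by (simp add: field_simps)
  moreover have "real n ^ k / real n ^ l = real n powi (- (int l - int k))"
    using n by (simp add: power_int_diff)
  ultimately have "y = of_int m / real n ^ l + real n powi (- (int l - int k)) * x" by simp
  then show "\<exists>(k::int) (m::int) (i::nat). y = of_int m / real n ^ i + real n powi (- k) * x" by blast
next
  assume "\<exists>(k::int) (m::int) (i::nat). y = of_int m / real n ^ i + real n powi (- k) * x"
  then obtain k :: int and m :: int and i :: nat
    where y: "y = of_int m / real n ^ i + real n powi (- k) * x" by blast
  define p q where "p = nat k" and "q = nat (- k)"
  have "real n powi (- k) * real n ^ p = real n ^ q"
  proof (cases "k \<ge> 0")
    case True
    then have "k = int p" "q = 0" by (simp_all add: p_def q_def)
    then show ?thesis using n by (simp add: power_int_minus)
  next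
    case False
    then have "- k = int q" "p = 0" by (simp_all add: p_def q_def)
    then show ?thesis using n by (simp only: \<open>- k = int q\<close> \<open>p = 0\<close> power_int_of_nat) simp
  qed
  then have "real n ^ p * y = real n ^ q * x + of_int (m * int n ^ p) / real n ^ i"
    unfolding y by (simp add: algebra_simps flip: mult.assoc)
  then have "digits n y (Suc i + j + p) = digits n x (Suc i + j + q)" for j
    using digits_add[OF n, of "real n ^ q * x" "m * int n ^ p" i j] by (metis digits_shift)
  then have "digits n x ((Suc i + q) + j) = digits n y ((Suc i + p) + j)" for j
    by (metis add.assoc add.commute)
  then show "tail_eq (digits n x) (digits n y)" unfolding tail_eq_def by blast
qed

section \<open>Borel maps into spaces of subsets\<close>

lemma space_borel_of [simp]: "space (borel_of X) = topspace X"
  by (simp add: borel_of_def space_measure_of_conv)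

lemma open_in_borel_of: "openin X U \<Longrightarrow> U \<in> sets (borel_of X)"
  unfolding borel_of_def by (rule in_measure_of) (auto dest: openin_subset)

lemma measurable_borel_ofI:
  assumes "f \<in> space M \<rightarrow> topspace X"
    and "\<And>U. openin X U \<Longrightarrow> f -` U \<inter> space M \<in> sets M"
  shows "f \<in> M \<rightarrow>\<^sub>M borel_of X"
  unfolding borel_of_def
  by (rule measurable_measure_of) (use assms in \<open>auto dest: openin_subset\<close>)

lemma openin_power_two_coordinate:
  assumes "i \<in> I"
  shows "openin (power_two I) {x \<in> topspace (power_two I). x i}"
proof -
  have "continuous_map (power_two I) (discrete_topology UNIV) (\<lambda>x. x i)"
    unfolding power_two_def by (rule continuous_map_product_projection[OF assms])
  from openin_continuous_map_preimage[OF this, of "{True}"] show ?thesis by simp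
qed

text \<open>Open sets are countable unions of cylinders, each given by two finite sets of indices.\<close>

lemma measurable_power_two:
  fixes f :: "'m \<Rightarrow> 'i \<Rightarrow> bool"
  assumes I: "countable I" and f: "f \<in> space M \<rightarrow> extensional I"
    and coord: "\<And>i. i \<in> I \<Longrightarrow> {x \<in> space M. f x i} \<in> sets M"
  shows "f \<in> M \<rightarrow>\<^sub>M borel_of (power_two I)"
proof (rule measurable_borel_ofI)
  show "f \<in> space M \<rightarrow> topspace (power_two I)"
    using f by (auto simp: power_two_def PiE_def)
  fix U assume U: "openin (power_two I) U"
  define C :: "'i set \<times> 'i set \<Rightarrow> ('i \<Rightarrow> bool) set" where
    "C = (\<lambda>(F, T). {x \<in> extensional I. (\<forall>i\<in>F. x i) \<and> (\<forall>i\<in>T. \<not> x i)})"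
  define K where "K = {F. finite F \<and> F \<subseteq> I} \<times> {F. finite F \<and> F \<subseteq> I}"
  have "countable K"
    unfolding K_def by (intro countable_SIGMA countable_Collect_finite_subset I)
  define W where "W = {k \<in> K. C k \<subseteq> U}"
  have U_eq: "U = (\<Union>k\<in>W. C k)"
  proof (intro equalityI subsetI)
    fix x assume x: "x \<in> U"
    obtain V where V: "finite {i \<in> I. V i \<noteq> UNIV}" "x \<in> PiE I V" "PiE I V \<subseteq> U"
      using U x unfolding power_two_def openin_product_topology_alt by force
    define D where "D = {i \<in> I. V i \<noteq> UNIV}"
    let ?k = "({i\<in>D. x i}, {i\<in>D. \<not> x i})"
    have k: "?k \<in> K" using V(1) by (auto simp: K_def D_def elim: rev_finite_subset)
    have xk: "x \<in> C ?k" using V(2) by (auto simp: C_def PiE_def)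
    have "C ?k \<subseteq> PiE I V"
    proof
      fix y assume y: "y \<in> C ?k"
      have "y i \<in> V i" if "i \<in> I" for i
      proof (cases "i \<in> D")
        case True
        then have "y i = x i" using y by (auto simp: C_def)
        then show ?thesis using V(2) that by auto
      qed (use that in \<open>auto simp: D_def\<close>)
      then show "y \<in> PiE I V" using y by (auto simp: C_def PiE_def)
    qed
    then have "?k \<in> W" using k subset_trans[OF _ V(3)] unfolding W_def by simp
    then show "x \<in> (\<Union>k\<in>W. C k)" using xk by (rule UN_I)
  qed (auto simp: W_def)
  have preimage: "f -` U \<inter> space M = (\<Union>k\<in>W. f -` C k \<inter> space M)"
    unfolding U_eq by blast
  have cylinder: "f -` C k \<inter> space M \<in> sets M" if k: "k \<in> K" for k
  proof -
    obtain F T where kFT: "k = (F, T)" by (cases k)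
    then have fin: "finite F" "F \<subseteq> I" "finite T" "T \<subseteq> I" using k by (auto simp: K_def)
    have "f -` C k \<inter> space M = {x \<in> space M. (\<forall>i\<in>F. f x i) \<and> (\<forall>i\<in>T. \<not> f x i)}"
      using f by (auto simp: C_def kFT)
    also have "\<dots> \<in> sets M"
    proof -
      have pos: "Measurable.pred M (\<lambda>x. f x i)" if "i \<in> I" for i
        using coord[OF that] by (simp add: pred_def)
      have neg: "Measurable.pred M (\<lambda>x. \<not> f x i)" if "i \<in> I" for i
        using pos[OF that] by measurable
      have "Measurable.pred M (\<lambda>x. \<forall>i\<in>F. f x i)"
        by (rule pred_intros_finite(3)[OF fin(1)]) (use pos fin(2) in blast)
      moreover have "Measurable.pred M (\<lambda>x. \<forall>i\<in>T. \<not> f x i)"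
        by (rule pred_intros_finite(3)[OF fin(3)]) (use neg fin(4) in blast)
      ultimately have "Measurable.pred M (\<lambda>x. (\<forall>i\<in>F. f x i) \<and> (\<forall>i\<in>T. \<not> f x i))"
        by measurable
      then show ?thesis unfolding pred_def .
    qed
    finally show ?thesis .
  qed
  have "countable W"
    using \<open>countable K\<close> by (rule countable_subset[rotated]) (simp add: W_def)
  then show "f -` U \<inter> space M \<in> sets M"
    unfolding preimage by (rule sets.countable_UN'') (rule cylinder, simp add: W_def)
qed

lemma measurable_LO_topology:
  assumes c: "countable (carrier G)" and f: "f \<in> space M \<rightarrow> LO G"
    and coord: "\<And>g. g \<in> carrier G \<Longrightarrow> {x \<in> space M. g \<in> f x} \<in> sets M"
  shows "f \<in> M \<rightarrow>\<^sub>M borel_of (LO_topology G)"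
proof (rule measurable_borel_ofI)
  show "f \<in> space M \<rightarrow> topspace (LO_topology G)"
    using f by (simp add: topspace_LO_topology)
  fix U assume "openin (LO_topology G) U"
  then obtain V where V: "openin (power_two (carrier G)) V"
    and U: "U = (\<lambda>A. \<lambda>i\<in>carrier G. i \<in> A) -` V \<inter> Pow (carrier G) \<inter> LO G"
    unfolding LO_topology_def openin_subtopology powerset_topology_def openin_pullback_topology by blast
  let ?h = "\<lambda>x. \<lambda>i\<in>carrier G. i \<in> f x"
  have "?h \<in> M \<rightarrow>\<^sub>M borel_of (power_two (carrier G))"
  proof (rule measurable_power_two[OF c])
    show "{x \<in> space M. ?h x i} \<in> sets M" if "i \<in> carrier G" for i
      using coord[OF that] that by simp
  qed auto
  then have "?h -` V \<inter> space M \<in> sets M"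
    using open_in_borel_of[OF V] by (rule measurable_sets)
  moreover have "f -` U \<inter> space M = ?h -` V \<inter> space M"
  proof -
    have "f x \<in> U \<longleftrightarrow> ?h x \<in> V" if "x \<in> space M" for x
    proof -
      have "f x \<in> LO G" using f that by (rule Pi_mem)
      moreover from this have "f x \<in> Pow (carrier G)" by (simp add: LO_def positive_cone_def)
      ultimately show ?thesis by (simp only: U Int_iff vimage_eq simp_thms)
    qed
    then show ?thesis by blast
  qed
  ultimately show "f -` U \<inter> space M \<in> sets M" by (simp only:)
qed
lemma LO_coordinate_measurable:
  assumes "g \<in> carrier G"
  shows "Measurable.pred (borel_of (LO_topology G)) (\<lambda>P. g \<in> P)"
proof -
  let ?V = "{x \<in> topspace (power_two (carrier G)). x g}"
  let ?h = "\<lambda>A. \<lambda>i\<in>carrier G. i \<in> A"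
  have "openin (powerset_topology (carrier G)) (?h -` ?V \<inter> Pow (carrier G))"
    unfolding powerset_topology_def openin_pullback_topology
    by (rule exI, rule conjI, rule openin_power_two_coordinate[OF assms], rule HOL.refl)
  then have "openin (LO_topology G) (?h -` ?V \<inter> Pow (carrier G) \<inter> LO G)"
    unfolding LO_topology_def by (rule openin_subtopology_Int)
  moreover have "?h -` ?V \<inter> Pow (carrier G) \<inter> LO G = {P \<in> LO G. g \<in> P}"
    using assms by (auto simp: power_two_def LO_def positive_cone_def)
  ultimately have "openin (LO_topology G) {P \<in> LO G. g \<in> P}" by simp
  from open_in_borel_of[OF this] show ?thesis
    unfolding pred_def space_borel_of topspace_LO_topology .
qed

lemma power_two_coordinate_measurable:
  assumes "i \<in> I"
  shows "Measurable.pred (borel_of (power_two I)) (\<lambda>x. x i)"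
  using open_in_borel_of[OF openin_power_two_coordinate[OF assms]]
  unfolding pred_def space_borel_of .

lemma digits_measurable: "(\<lambda>x. digits n x j) \<in> borel \<rightarrow>\<^sub>M count_space UNIV"
proof -
  have "(\<lambda>x. \<lfloor>real n ^ j * x\<rfloor>) \<in> borel \<rightarrow>\<^sub>M count_space UNIV"
    by (rule measurable_compose[OF _ measurable_real_floor]) measurable
  then show ?thesis
    unfolding digits_def by (rule measurable_compose) simp
qed

text \<open>The indicator sequence of the graph of \<open>u\<close>. It turns eventual equality of sequences over a countable
  alphabet into eventual equality of bit sequences.\<close>

definition graph_seq :: "(nat \<Rightarrow> 'a::countable) \<Rightarrow> nat \<Rightarrow> bool" where
  "graph_seq u k \<longleftrightarrow> (\<exists>m. k = to_nat (m, u m))"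

text \<open>Sequences that differ at only finitely many places have graphs with finite symmetric difference, and
  conversely, since a graph has one point over each index.\<close>

lemma graph_seq_E0:
  "(graph_seq u, graph_seq v) \<in> E0 \<longleftrightarrow> (\<exists>m0. \<forall>m\<ge>m0. u m = v m)"
proof
  assume "(graph_seq u, graph_seq v) \<in> E0"
  then obtain b where b: "\<And>k. k > b \<Longrightarrow> graph_seq u k = graph_seq v k" unfolding E0_def by blast
  have "finite {m. to_nat (m, u m) \<le> b}"
  proof (rule finite_imageD)
    show "finite ((\<lambda>m. to_nat (m, u m)) ` {m. to_nat (m, u m) \<le> b})"
      by (rule finite_subset[of _ "{..b}"]) auto
  qed (auto simp: inj_on_def)
  then obtain m0 where m0: "\<And>m. to_nat (m, u m) \<le> b \<Longrightarrow> m < m0"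
    by (metis (mono_tags, lifting) finite_nat_bounded lessThan_iff mem_Collect_eq subsetD)
  have "u m = v m" if m: "m \<ge> m0" for m
  proof -
    have "to_nat (m, u m) > b" using m0[of m] m by force
    moreover have "graph_seq u (to_nat (m, u m))" by (auto simp: graph_seq_def)
    ultimately have "graph_seq v (to_nat (m, u m))" using b by blast
    then show ?thesis by (auto simp: graph_seq_def)
  qed
  then show "\<exists>m0. \<forall>m\<ge>m0. u m = v m" by blast
next
  assume "\<exists>m0. \<forall>m\<ge>m0. u m = v m"
  then obtain m0 where m0: "\<And>m. m \<ge> m0 \<Longrightarrow> u m = v m" by blast
  define b where "b = (\<Sum>m<m0. to_nat (m, u m) + to_nat (m, v m))"
  have le: "to_nat (m, u m) \<le> b" "to_nat (m, v m) \<le> b" if "m < m0" for m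
  proof -
    have "to_nat (m, u m) + to_nat (m, v m) \<le> b"
      unfolding b_def using that
      by (intro member_le_sum[where f = "\<lambda>m. to_nat (m, u m) + to_nat (m, v m)"]) auto
    then show "to_nat (m, u m) \<le> b" "to_nat (m, v m) \<le> b" by auto
  qed
  have "graph_seq u k = graph_seq v k" if k: "k > b" for k
  proof -
    have "k = to_nat (m, u m) \<longleftrightarrow> k = to_nat (m, v m)" for m
      using k le[of m] m0[of m] by (cases "m < m0") auto
    then show ?thesis by (simp add: graph_seq_def)
  qed
  then show "(graph_seq u, graph_seq v) \<in> E0" unfolding E0_def by blast
qed

text \<open>Every ingredient of the code takes values in a countable set and is described by countable
  quantifiers over the letters of the sequence.\<close>

lemma tail_code_measurable:
  assumes d: "\<And>i. (\<lambda>x. d x i) \<in> M \<rightarrow>\<^sub>M count_space UNIV"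
  shows "(\<lambda>x. tail_code (d x) m) \<in> M \<rightarrow>\<^sub>M count_space UNIV"
proof -
  have letter: "Measurable.pred M (\<lambda>x. d x i = c)" for i c
    by (rule measurable_compose[OF d]) simp
  have occ: "Measurable.pred M (\<lambda>x. occurs (d x) w p)" for w p
    unfolding occurs_def by (intro pred_intros_countable pred_intros_imp' letter)
  have rec: "Measurable.pred M (\<lambda>x. recurs (d x) w)" for w
    unfolding recurs_def by (intro pred_intros_countable pred_intros_conj1' pred_intros_imp' occ)
  have rw: "(\<lambda>x. rec_word (d x) m) \<in> M \<rightarrow>\<^sub>M count_space UNIV" for m
  proof (induction m)
    case (Suc m)
    have "(\<lambda>x. LEAST c. recurs (d x) (w @ [c])) \<in> M \<rightarrow>\<^sub>M count_space UNIV" for w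
      by (intro measurable_Least rec)
    then have "(\<lambda>x. w @ [LEAST c. recurs (d x) (w @ [c])]) \<in> M \<rightarrow>\<^sub>M count_space UNIV" for w
      by (rule measurable_compose) simp
    then show ?case
      unfolding rec_word.simps by (rule measurable_compose_countable[OF _ Suc])
  qed simp
  have lim: "(\<lambda>x. rec_limit (d x) i) \<in> M \<rightarrow>\<^sub>M count_space UNIV" for i
    unfolding rec_limit_def by (rule measurable_compose[OF rw]) simp
  have fo: "(\<lambda>x. first_occ (d x) m) \<in> M \<rightarrow>\<^sub>M count_space UNIV" for m
    unfolding first_occ_def
    by (rule measurable_compose_countable[OF _ rw[of m]]) (intro measurable_Least occ)
  have seg0: "(\<lambda>x. map (d x) l) \<in> M \<rightarrow>\<^sub>M count_space UNIV" for l
  proof (induction l)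
    case (Cons a l)
    have "(\<lambda>x. v # map (d x) l) \<in> M \<rightarrow>\<^sub>M count_space UNIV" for v
      by (rule measurable_compose[OF Cons]) simp
    then show ?case by (auto intro: measurable_compose_countable[OF _ d[of a]])
  qed simp
  have upt: "(\<lambda>x. [first_occ (d x) m..<first_occ (d x) m']) \<in> M \<rightarrow>\<^sub>M count_space UNIV" for m m'
    by (rule measurable_compose_countable[OF _ fo[of m]], rule measurable_compose[OF fo[of m']]) simp
  have seg: "(\<lambda>x. map (d x) [first_occ (d x) m..<first_occ (d x) m']) \<in> M \<rightarrow>\<^sub>M count_space UNIV" for m m'
    by (rule measurable_compose_countable[OF seg0 upt])
  have agree: "Measurable.pred M (\<lambda>x. d x i = rec_limit (d x) j)" for i j
    by (rule measurable_compose_countable[OF letter lim])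
  have hit: "Measurable.pred M (\<lambda>x. tail_eq (d x) (rec_limit (d x)))"
    unfolding tail_eq_def by (intro pred_intros_countable agree)
  have "(\<lambda>x. (True, rec_word (d x) m)) \<in> M \<rightarrow>\<^sub>M count_space UNIV"
    by (rule measurable_compose[OF rw]) simp
  moreover have "(\<lambda>x. (False, map (d x) [first_occ (d x) m..<first_occ (d x) (Suc m)])) \<in> M \<rightarrow>\<^sub>M count_space UNIV"
    by (rule measurable_compose[OF seg]) simp
  ultimately show ?thesis
    unfolding tail_code_def using hit by (intro measurable_If) (auto simp: pred_def)
qed

section \<open>Groups with affine representations, and conjugation of cones\<close>

text \<open>A homomorphism to the affine group of the line: \<open>x\<close> acts as \<open>t \<mapsto> tr x + n^(- sl x) t\<close>.\<close>

locale affine_rep = group G for G (structure) +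
  fixes n :: nat and sl :: "'a \<Rightarrow> int" and tr :: "'a \<Rightarrow> real"
  assumes n2: "n \<ge> 2"
    and sl_mult: "x \<in> carrier G \<Longrightarrow> y \<in> carrier G \<Longrightarrow> sl (x \<otimes> y) = sl x + sl y"
    and tr_mult: "x \<in> carrier G \<Longrightarrow> y \<in> carrier G \<Longrightarrow> tr (x \<otimes> y) = tr x + real n powi (- sl x) * tr y"
begin

lemma n_pos: "real n > 0" "real n > 1"
  using n2 by auto

lemma sl_one: "sl \<one> = 0"
  using sl_mult[of \<one> \<one>] by simp

lemma tr_one: "tr \<one> = 0"
  using tr_mult[of \<one> \<one>] by (simp add: sl_one)

lemma sl_inv: "x \<in> carrier G \<Longrightarrow> sl (inv x) = - sl x"
  using sl_mult[of "inv x" x] by (simp add: sl_one)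

lemma tr_inv: "x \<in> carrier G \<Longrightarrow> tr (inv x) = - (real n powi (sl x) * tr x)"
  using tr_mult[of "inv x" x] by (simp add: tr_one sl_inv)

lemma sl_pow: "x \<in> carrier G \<Longrightarrow> sl (x [^] (k::nat)) = int k * sl x"
  by (induction k) (simp_all add: sl_one sl_mult algebra_simps)

lemma tr_pow: "x \<in> carrier G \<Longrightarrow> sl x = 0 \<Longrightarrow> tr (x [^] (k::nat)) = real k * tr x"
  by (induction k) (simp_all add: tr_one tr_mult sl_pow algebra_simps)

definition act :: "'a \<Rightarrow> real \<Rightarrow> real" where
  "act g t = tr g + real n powi (- sl g) * t"

lemma act_mult: "x \<in> carrier G \<Longrightarrow> y \<in> carrier G \<Longrightarrow> act (x \<otimes> y) t = act x (act y t)"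
  using n_pos power_int_add[of "real n" "- sl x" "- sl y"]
  by (simp add: act_def sl_mult tr_mult algebra_simps)

lemma act_one: "act \<one> t = t"
  by (simp add: act_def sl_one tr_one)

lemma act_inv: "x \<in> carrier G \<Longrightarrow> act (inv x) (act x t) = t" "x \<in> carrier G \<Longrightarrow> act x (act (inv x) t) = t"
  by (simp_all add: act_mult[symmetric] act_one)

lemma act_less_iff: "act x s < act x t \<longleftrightarrow> s < t"
  using n_pos by (simp add: act_def)

lemma act_eq_iff: "act x s = act x t \<longleftrightarrow> s = t"
  using act_less_iff[of x s t] act_less_iff[of x t s] by linarith

text \<open>The fixed point of the affine map, which exists and is unique when \<open>sl g \<noteq> 0\<close>.\<close>

definition fixp :: "'a \<Rightarrow> real" where
  "fixp g = tr g / (1 - real n powi (- sl g))"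

lemma slope_less_one: "sl g > 0 \<Longrightarrow> real n powi (- sl g) < 1"
  using n_pos by (simp add: power_int_minus one_less_power_int inverse_less_1_iff)

lemma tr_fixp: "sl g > 0 \<Longrightarrow> tr g = (1 - real n powi (- sl g)) * fixp g"
  using slope_less_one[of g] by (simp add: fixp_def)

lemma act_fixp: "sl g > 0 \<Longrightarrow> act g (fixp g) = fixp g"
  using tr_fixp[of g] by (simp add: act_def algebra_simps)

lemma fixp_unique: "sl g > 0 \<Longrightarrow> act g t = t \<Longrightarrow> fixp g = t"
  using slope_less_one[of g] by (simp add: fixp_def act_def field_simps)

lemma act_greater_iff: "sl g > 0 \<Longrightarrow> act g t > t \<longleftrightarrow> t < fixp g"
  using slope_less_one[of g] by (simp add: fixp_def act_def field_simps)

lemma act_less_self_iff: "sl g > 0 \<Longrightarrow> act g t < t \<longleftrightarrow> fixp g < t"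
  using slope_less_one[of g] by (simp add: fixp_def act_def field_simps)

lemma fixp_pow:
  assumes "g \<in> carrier G" "sl g > 0" "k > 0"
  shows "fixp (g [^] (k::nat)) = fixp g"
proof (rule fixp_unique)
  show "sl (g [^] k) > 0" using assms by (simp add: sl_pow)
  have "act (g [^] k) (fixp g) = fixp g" for k :: nat
    by (induction k) (use assms in \<open>simp_all add: act_one act_mult act_fixp\<close>)
  then show "act (g [^] k) (fixp g) = fixp g" .
qed

lemma fixp_conj:
  assumes "g \<in> carrier G" "h \<in> carrier G" "sl h > 0"
  shows "fixp (g \<otimes> h \<otimes> inv g) = act g (fixp h)"
  by (rule fixp_unique) (use assms in \<open>simp_all add: sl_mult sl_inv act_mult act_inv act_fixp\<close>)

end

context group
begin

lemma positive_cone_iff: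
  "positive_cone G P \<longleftrightarrow> P \<subseteq> carrier G \<and> (\<forall>g\<in>P. inv g \<notin> P) \<and> (\<forall>g\<in>P. \<forall>h\<in>P. g \<otimes> h \<in> P) \<and>
     (\<forall>g\<in>carrier G. g \<in> P \<or> inv g \<in> P \<or> g = \<one>)" (is "_ = ?R")
proof
  assume c: "positive_cone G P"
  then have sub: "P \<subseteq> carrier G" by (simp add: positive_cone_def)
  have "inv g \<notin> P" if "g \<in> P" for g
    using c that by (auto simp: positive_cone_def SET_INV_def)
  moreover have "g \<otimes> h \<in> P" if "g \<in> P" "h \<in> P" for g h
  proof -
    have "g \<otimes> h \<in> P <#> P" using that by (auto simp: set_mult_def)
    then show ?thesis using c by (auto simp: positive_cone_def)
  qed
  moreover have "g \<in> P \<or> inv g \<in> P \<or> g = \<one>" if "g \<in> carrier G" for g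
  proof -
    have "g \<in> P \<union> set_inv P \<union> {\<one>}" using c that by (simp add: positive_cone_def)
    then show ?thesis using sub by (auto simp: SET_INV_def)
  qed
  ultimately show ?R using sub by blast
next
  assume r: ?R
  then have "set_inv P = {g \<in> carrier G. inv g \<in> P}"
    by (force simp: SET_INV_def)
  then show "positive_cone G P"
    using r by (auto simp: positive_cone_def set_mult_def)
qed

lemma
  assumes "positive_cone G P"
  shows cone_carrier: "g \<in> P \<Longrightarrow> g \<in> carrier G"
    and cone_asym: "g \<in> P \<Longrightarrow> inv g \<notin> P"
    and cone_mult: "g \<in> P \<Longrightarrow> h \<in> P \<Longrightarrow> g \<otimes> h \<in> P"
    and cone_total: "g \<in> carrier G \<Longrightarrow> g \<noteq> \<one> \<Longrightarrow> g \<notin> P \<Longrightarrow> inv g \<in> P"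
  using assms unfolding positive_cone_iff by blast+

lemma cone_one: "positive_cone G P \<Longrightarrow> \<one> \<notin> P"
  using cone_asym[of P \<one>] by auto

lemma cone_pow:
  assumes "positive_cone G P" "g \<in> P" "k > 0"
  shows "g [^] (k::nat) \<in> P"
  using assms(3)
proof (induction k)
  case (Suc k)
  then show ?case
    using assms(1,2) cone_mult[OF assms(1)] cone_carrier[OF assms(1,2)] by (cases "k = 0") auto
qed simp

text \<open>Positivity is inherited by roots: an element and its inverse cannot both have positive powers.\<close>

lemma cone_pow_iff:
  assumes P: "positive_cone G P" and g: "g \<in> carrier G" "g \<noteq> \<one>" and k: "k > 0"
  shows "g [^] (k::nat) \<in> P \<longleftrightarrow> g \<in> P"
proof
  assume p: "g [^] k \<in> P"
  show "g \<in> P"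
  proof (rule ccontr)
    assume "g \<notin> P"
    then have "inv g [^] k \<in> P" using cone_total[OF P g] cone_pow[OF P _ k] by blast
    then show False using cone_asym[OF P p] g by (simp add: nat_pow_inv)
  qed
qed (use cone_pow[OF P _ k] in blast)

definition conj_set :: "'a \<Rightarrow> 'a set \<Rightarrow> 'a set" where
  "conj_set g P = {h \<in> carrier G. inv g \<otimes> h \<otimes> g \<in> P}"

lemma conj_set_coset:
  assumes "g \<in> carrier G" "P \<subseteq> carrier G"
  shows "g <# P #> inv g = conj_set g P"
proof
  show "g <# P #> inv g \<subseteq> conj_set g P"
  proof
    fix h assume "h \<in> g <# P #> inv g"
    then obtain p where p: "p \<in> P" "h = g \<otimes> p \<otimes> inv g" by (auto simp: l_coset_def r_coset_def)
    then have "p \<in> carrier G" using assms by blast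
    then have "inv g \<otimes> h \<otimes> g = p" unfolding p(2)
      using assms by (simp add: m_assoc) (simp add: m_assoc[symmetric])
    then show "h \<in> conj_set g P" using p assms by (auto simp: conj_set_def)
  qed
next
  show "conj_set g P \<subseteq> g <# P #> inv g"
  proof
    fix h assume h: "h \<in> conj_set g P"
    then have "h = g \<otimes> (inv g \<otimes> h \<otimes> g) \<otimes> inv g"
      using assms by (simp add: conj_set_def m_assoc) (simp add: m_assoc[symmetric])
    then show "h \<in> g <# P #> inv g"
      using h by (auto simp: l_coset_def r_coset_def conj_set_def)
  qed
qed

lemma conj_cone:
  assumes P: "positive_cone G P" and g: "g \<in> carrier G"
  shows "positive_cone G (conj_set g P)"
  unfolding positive_cone_iff
proof (intro conjI ballI)
  have inv_conj: "inv g \<otimes> inv h \<otimes> g = inv (inv g \<otimes> h \<otimes> g)" if "h \<in> carrier G" for h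
    using g that by (simp add: inv_mult_group m_assoc)
  show "conj_set g P \<subseteq> carrier G" by (auto simp: conj_set_def)
  show "inv h \<notin> conj_set g P" if "h \<in> conj_set g P" for h
    using that cone_asym[OF P] by (auto simp: conj_set_def inv_conj)
  show "h \<otimes> k \<in> conj_set g P" if hk: "h \<in> conj_set g P" "k \<in> conj_set g P" for h k
  proof -
    have c: "h \<in> carrier G" "k \<in> carrier G" using hk by (auto simp: conj_set_def)
    have "(inv g \<otimes> h \<otimes> g) \<otimes> (inv g \<otimes> k \<otimes> g) = inv g \<otimes> (h \<otimes> k) \<otimes> g"
      using g c by (simp add: m_assoc) (simp add: m_assoc[symmetric])
    then show ?thesis
      using hk c cone_mult[OF P, of "inv g \<otimes> h \<otimes> g" "inv g \<otimes> k \<otimes> g"] by (simp add: conj_set_def)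
  qed
  show "h \<in> conj_set g P \<or> inv h \<in> conj_set g P \<or> h = \<one>" if h: "h \<in> carrier G" for h
  proof (cases "inv g \<otimes> h \<otimes> g = \<one>")
    case True
    then have "g \<otimes> (inv g \<otimes> h \<otimes> g) \<otimes> inv g = \<one>" using g by simp
    moreover have "g \<otimes> (inv g \<otimes> h \<otimes> g) \<otimes> inv g = h"
      using g h by (simp add: m_assoc) (simp add: m_assoc[symmetric])
    ultimately show ?thesis by simp
  next
    case False
    then show ?thesis
      using cone_total[OF P, of "inv g \<otimes> h \<otimes> g"] g h by (auto simp: conj_set_def inv_conj)
  qed
qed

lemma conj_set_inv:
  assumes "P \<subseteq> carrier G" "g \<in> carrier G"
  shows "conj_set (inv g) (conj_set g P) = P"
proof -
  have "inv g \<otimes> (g \<otimes> h \<otimes> inv g) \<otimes> g = h" if "h \<in> carrier G" for h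
    using that assms(2) by (simp add: m_assoc) (simp add: m_assoc[symmetric])
  then show ?thesis using assms by (auto simp: conj_set_def)
qed

definition opposite :: "'a set \<Rightarrow> 'a set" where
  "opposite P = {g \<in> carrier G. inv g \<in> P}"

lemma opposite_opposite: "P \<subseteq> carrier G \<Longrightarrow> opposite (opposite P) = P"
  by (auto simp: opposite_def)

lemma opposite_cone:
  assumes P: "positive_cone G P"
  shows "positive_cone G (opposite P)"
  unfolding positive_cone_iff
proof (intro conjI ballI)
  show "g \<otimes> h \<in> opposite P" if "g \<in> opposite P" "h \<in> opposite P" for g h
    using that cone_mult[OF P, of "inv h" "inv g"] by (auto simp: opposite_def inv_mult_group)
qed (use cone_asym[OF P] cone_total[OF P] in \<open>auto simp: opposite_def\<close>)

lemma conj_opposite: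
  assumes "g \<in> carrier G"
  shows "conj_set g (opposite P) = opposite (conj_set g P)"
  using assms by (auto simp: conj_set_def opposite_def inv_mult_group m_assoc)

lemma E_lo_iff:
  "(P, Q) \<in> E_lo G \<longleftrightarrow> positive_cone G P \<and> positive_cone G Q \<and> (\<exists>g\<in>carrier G. conj_set g P = Q)"
proof -
  have "g <# P #> inv g = conj_set g P" if "positive_cone G P" "g \<in> carrier G" for g
    using that conj_set_coset by (auto simp: positive_cone_def)
  then show ?thesis unfolding E_lo_def LO_def by auto
qed

end

section \<open>Classification of positive cones by cuts\<close>

text \<open>The group of all maps \<open>t \<mapsto> n^(-k) t + x\<close> with \<open>k\<close> an integer and \<open>x \<in> \<int>[1/n]\<close>, up to isomorphism.\<close>

locale affine_group = affine_rep +
  assumes rep_inj: "x \<in> carrier G \<Longrightarrow> y \<in> carrier G \<Longrightarrow> sl x = sl y \<Longrightarrow> tr x = tr y \<Longrightarrow> x = y"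
    and tr_range: "x \<in> carrier G \<Longrightarrow> \<exists>(m::int) (j::nat). tr x = of_int m / real n ^ j"
    and rep_surj: "\<And>k (m::int) (j::nat). \<exists>x\<in>carrier G. sl x = k \<and> tr x = of_int m / real n ^ j"
begin

definition elt :: "int \<Rightarrow> int \<Rightarrow> nat \<Rightarrow> 'a" where
  "elt k m j = (SOME x. x \<in> carrier G \<and> sl x = k \<and> tr x = of_int m / real n ^ j)"

lemma elt: "elt k m j \<in> carrier G" "sl (elt k m j) = k" "tr (elt k m j) = of_int m / real n ^ j"
proof -
  have "\<exists>x. x \<in> carrier G \<and> sl x = k \<and> tr x = of_int m / real n ^ j"
    using rep_surj[of k m j] by blast
  from someI_ex[OF this]
  show "elt k m j \<in> carrier G" "sl (elt k m j) = k" "tr (elt k m j) = of_int m / real n ^ j"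
    unfolding elt_def by auto
qed

lemma countable_carrier: "countable (carrier G)"
proof -
  have "carrier G \<subseteq> (\<lambda>(k, m, j). elt k m j) ` UNIV"
  proof
    fix x assume x: "x \<in> carrier G"
    obtain m :: int and j :: nat where "tr x = of_int m / real n ^ j" using tr_range[OF x] by blast
    then have "x = elt (sl x) m j" using rep_inj[OF x] elt by simp
    then show "x \<in> (\<lambda>(k, m, j). elt k m j) ` UNIV" by (metis UNIV_I case_prod_conv image_eqI)
  qed
  then show ?thesis by (rule countable_subset) simp
qed

abbreviation shift :: 'a where
  "shift \<equiv> elt 0 1 0"

lemma act_orbit:
  "(\<exists>g\<in>carrier G. act g x = y) \<longleftrightarrow> tail_eq (digits n x) (digits n y)"
  unfolding digits_tail_eq_iff[OF n2]
proof
  assume "\<exists>g\<in>carrier G. act g x = y"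
  then show "\<exists>k (m::int) (i::nat). y = of_int m / real n ^ i + real n powi (- k) * x"
    using tr_range unfolding act_def by metis
next
  assume "\<exists>k (m::int) (i::nat). y = of_int m / real n ^ i + real n powi (- k) * x"
  then obtain k m i where "y = of_int m / real n ^ i + real n powi (- k) * x" by blast
  then have "act (elt k m i) x = y" by (simp add: act_def elt)
  then show "\<exists>g\<in>carrier G. act g x = y" using elt(1) by blast
qed

lemma fixp_dense:
  assumes "x < y"
  shows "\<exists>h\<in>carrier G. sl h = 1 \<and> x < fixp h \<and> fixp h < y"
proof -
  define c where "c = 1 - 1 / real n"
  have c: "c > 0" using n_pos by (simp add: c_def)
  obtain j where j: "(1 / real n) ^ j < c * (y - x)"
    using real_arch_pow_inv[of "c * (y - x)" "1 / real n"] assms c n_pos by auto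
  define m where "m = \<lfloor>real n ^ j * (c * x)\<rfloor> + 1"
  have nj: "real n ^ j > 0" using n_pos by simp
  have "real n ^ j * (c * x) < of_int m" "of_int m \<le> real n ^ j * (c * x) + 1"
    unfolding m_def by linarith+
  then have 1: "c * x < of_int m / real n ^ j" and 2: "of_int m / real n ^ j \<le> c * x + 1 / real n ^ j"
    using nj by (auto simp: field_simps)
  define r where "r = of_int m / real n ^ j"
  have "c * x < r" using 1 by (simp only: r_def)
  moreover have "r < c * y"
    using 2 j by (simp add: r_def power_divide algebra_simps)
  moreover have "fixp (elt 1 m j) = r / c"
    by (simp add: fixp_def elt c_def r_def power_int_minus field_simps)
  ultimately have "x < fixp (elt 1 m j)" "fixp (elt 1 m j) < y"
    using c by (auto simp: pos_less_divide_eq pos_divide_less_eq mult.commute)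
  then show ?thesis using elt[of 1 m j] by blast
qed

text \<open>Every translation has a power that is an integral translation, hence a power of the shift by 1.\<close>

lemma translation_in_cone:
  assumes Q: "positive_cone G Q" and s: "shift \<in> Q" and g: "g \<in> carrier G" "sl g = 0"
  shows "g \<in> Q \<longleftrightarrow> tr g > 0"
proof -
  have pos: "h \<in> Q" if h: "h \<in> carrier G" "sl h = 0" "tr h > 0" for h
  proof -
    obtain m :: int and j :: nat where mj: "tr h = of_int m / real n ^ j" using tr_range[OF h(1)] by blast
    then have "m > 0" using h(3) n_pos by (simp add: zero_less_divide_iff)
    then obtain M where M: "M > 0" "m = int M" by (metis zero_less_imp_eq_int)
    have "h [^] (n ^ j) = shift [^] M"
      by (rule rep_inj) (use h M mj n_pos in \<open>simp_all add: sl_pow tr_pow elt\<close>)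
    then have "h [^] (n ^ j) \<in> Q" using cone_pow[OF Q s M(1)] by simp
    moreover have "h \<noteq> \<one>" using h(3) tr_one by auto
    ultimately show ?thesis using cone_pow_iff[OF Q h(1), of "n ^ j"] n2 by simp
  qed
  show ?thesis
  proof
    assume gQ: "g \<in> Q"
    have "tr g \<noteq> 0"
      using rep_inj[OF g(1) one_closed] g sl_one tr_one cone_one[OF Q] gQ by auto
    moreover have "\<not> tr g < 0"
      using pos[of "inv g"] cone_asym[OF Q gQ] g by (auto simp: sl_inv tr_inv)
    ultimately show "tr g > 0" by linarith
  qed (use pos g in blast)
qed

text \<open>With \<open>k = sl g\<close>, the map \<open>h^k\<close> has the slope of \<open>g\<close> and a smaller fixed point, so \<open>g\<close> is the
  composition of \<open>h^k\<close> with a translation to the right.\<close>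

lemma cone_above:
  assumes Q: "positive_cone G Q" "shift \<in> Q" and g: "g \<in> carrier G" "sl g > 0"
    and h: "h \<in> Q" "sl h = 1" and less: "fixp h < fixp g"
  shows "g \<in> Q"
proof -
  have hc: "h \<in> carrier G" using cone_carrier[OF Q(1) h(1)] .
  define k where "k = nat (sl g)"
  let ?u = "g \<otimes> inv (h [^] k)"
  have k: "k > 0" "sl g = int k" using g by (auto simp: k_def)
  have slhk: "sl (h [^] k) = sl g" using hc h k by (simp add: sl_pow)
  have g_eq: "g = ?u \<otimes> h [^] k" using g hc by (simp add: m_assoc)
  have slu: "sl ?u = 0" using g hc slhk by (simp add: sl_mult sl_inv)
  have "tr g = tr ?u + tr (h [^] k)"
    using tr_mult[of ?u "h [^] k"] g_eq slu g hc by simp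
  moreover have "tr (h [^] k) < tr g"
    using tr_fixp[of "h [^] k"] tr_fixp[of g] slhk fixp_pow[OF hc _ k(1)] h g less slope_less_one[of g]
    by simp
  ultimately have "?u \<in> Q" using translation_in_cone[OF Q, of ?u] slu g hc by simp
  then have "?u \<otimes> h [^] k \<in> Q"
    using cone_mult[OF Q(1) _ cone_pow[OF Q(1) h(1) k(1)]] by blast
  then show ?thesis by (simp only: g_eq[symmetric])
qed

lemma cone_below:
  assumes Q: "positive_cone G Q" "shift \<in> Q" and g: "g \<in> carrier G" "sl g > 0"
    and h: "h \<in> carrier G" "h \<notin> Q" "sl h = 1" and less: "fixp g < fixp h"
  shows "g \<notin> Q"
proof
  assume gQ: "g \<in> Q"
  define k where "k = nat (sl g)"
  let ?u = "h [^] k \<otimes> inv g"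
  have k: "k > 0" "sl g = int k" using g by (auto simp: k_def)
  have slhk: "sl (h [^] k) = sl g" using h k by (simp add: sl_pow)
  have hk_eq: "h [^] k = ?u \<otimes> g" using g h by (simp add: m_assoc)
  have slu: "sl ?u = 0" using g h slhk by (simp add: sl_mult sl_inv)
  have "tr (h [^] k) = tr ?u + tr g"
    using tr_mult[of ?u g] hk_eq slu g h by simp
  moreover have "tr (h [^] k) > tr g"
    using tr_fixp[of "h [^] k"] tr_fixp[of g] slhk fixp_pow[OF h(1) _ k(1)] h g less slope_less_one[of g]
    by simp
  ultimately have "?u \<in> Q" using translation_in_cone[OF Q, of ?u] slu g h by simp
  then have "?u \<otimes> g \<in> Q" using cone_mult[OF Q(1) _ gQ] by blast
  then have "h [^] k \<in> Q" by (simp only: hk_eq[symmetric])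
  moreover have "h \<noteq> \<one>" using h sl_one by auto
  ultimately show False using cone_pow_iff[OF Q(1) h(1) _ k(1)] h by blast
qed

text \<open>The value is \<open>\<infinity>\<close> or \<open>-\<infinity>\<close> exactly for the orders in which the translations form a convex subgroup:
  then either no contraction or every contraction is positive.\<close>

definition cut :: "'a set \<Rightarrow> ereal" where
  "cut Q = (INF h\<in>{h \<in> Q. sl h = 1}. ereal (fixp h))"

text \<open>How the order treats the contractions that fix the cut. There are none unless the cut is rational.\<close>

definition tie :: "'a set \<Rightarrow> bool" where
  "tie Q \<longleftrightarrow> (\<exists>g\<in>Q. sl g > 0 \<and> ereal (fixp g) = cut Q)"

text \<open>Off the cut this follows from the comparison of fixed points. Two contractions that both fix the cut
  have a common power, so they are positive together.\<close>

lemma cone_mem_iff: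
  assumes Q: "positive_cone G Q" "shift \<in> Q" and g: "g \<in> carrier G" "sl g > 0"
  shows "g \<in> Q \<longleftrightarrow> cut Q < ereal (fixp g) \<or> ereal (fixp g) = cut Q \<and> tie Q"
proof -
  consider "cut Q < ereal (fixp g)" | "ereal (fixp g) < cut Q" | "ereal (fixp g) = cut Q" by fastforce
  then show ?thesis
  proof cases
    case 1
    then obtain h where "h \<in> Q" "sl h = 1" "fixp h < fixp g"
      unfolding cut_def INF_less_iff by auto
    then show ?thesis using cone_above[OF Q g] 1 by blast
  next
    case 2
    then obtain r where r: "fixp g < r" "ereal r < cut Q"
      using ereal_dense2[of "ereal (fixp g)" "cut Q"] by auto
    obtain h where h: "h \<in> carrier G" "sl h = 1" "fixp g < fixp h" "fixp h < r"
      using fixp_dense[OF r(1)] by blast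
    have "h \<notin> Q"
    proof
      assume "h \<in> Q"
      then have "cut Q \<le> ereal (fixp h)" unfolding cut_def by (intro INF_lower) (use h in auto)
      also have "\<dots> < ereal r" using h by simp
      finally show False using r(2) by simp
    qed
    then show ?thesis using cone_below[OF Q g h(1) _ h(2,3)] 2 by auto
  next
    case 3
    have "g \<in> Q" if h: "h \<in> Q" "sl h > 0" "ereal (fixp h) = cut Q" for h
    proof -
      have hc: "h \<in> carrier G" using cone_carrier[OF Q(1) h(1)] .
      define k l where "k = nat (sl h)" and "l = nat (sl g)"
      have kl: "k > 0" "l > 0" "sl h = int k" "sl g = int l" using h g by (auto simp: k_def l_def)
      have sl: "sl (g [^] k) = sl (h [^] l)" using g hc kl by (simp add: sl_pow)
      have "g [^] k = h [^] l"
      proof (rule rep_inj)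
        have "fixp g = fixp h" using h(3) 3 by (metis ereal.inject)
        then have "fixp (g [^] k) = fixp (h [^] l)"
          using fixp_pow[OF g kl(1)] fixp_pow[OF hc h(2) kl(2)] by simp
        then show "tr (g [^] k) = tr (h [^] l)"
          using tr_fixp[of "g [^] k"] tr_fixp[of "h [^] l"] sl g hc kl by (simp add: sl_pow)
      qed (use sl g hc in auto)
      then have "g [^] k \<in> Q" using cone_pow[OF Q(1) h(1) kl(2)] by simp
      moreover have "g \<noteq> \<one>" using g sl_one by auto
      ultimately show ?thesis using cone_pow_iff[OF Q(1) g(1) _ kl(1)] by blast
    qed
    then show ?thesis using 3 g unfolding tie_def by auto
  qed
qed

lemma cone_determined:
  assumes Q: "positive_cone G Q" "shift \<in> Q" and Q': "positive_cone G Q'" "shift \<in> Q'"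
    and eq: "cut Q = cut Q'" "tie Q = tie Q'"
  shows "Q = Q'"
proof -
  have pos: "g \<in> Q \<longleftrightarrow> g \<in> Q'" if "g \<in> carrier G" "sl g > 0" for g
    using cone_mem_iff[OF Q that] cone_mem_iff[OF Q' that] eq by simp
  have neg: "g \<in> P \<longleftrightarrow> inv g \<notin> P" if "positive_cone G P" "g \<in> carrier G" "sl g < 0" for g P
  proof -
    have "g \<noteq> \<one>" using that sl_one by auto
    then show ?thesis using cone_asym[OF that(1), of g] cone_total[OF that(1,2)] by blast
  qed
  have "g \<in> Q \<longleftrightarrow> g \<in> Q'" if g: "g \<in> carrier G" for g
  proof -
    consider "sl g > 0" | "sl g = 0" | "sl g < 0" by linarith
    then show ?thesis
    proof cases
      case 1
      then show ?thesis using pos g by blast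
    next
      case 2
      then show ?thesis using translation_in_cone[OF Q g] translation_in_cone[OF Q' g] by blast
    next
      case 3
      then show ?thesis using neg[OF Q(1) g] neg[OF Q'(1) g] pos[of "inv g"] g by (simp add: sl_inv)
    qed
  qed
  then show ?thesis using cone_carrier[OF Q(1)] cone_carrier[OF Q'(1)] by blast
qed

definition eact :: "'a \<Rightarrow> ereal \<Rightarrow> ereal" where
  "eact g e = ereal (tr g) + ereal (real n powi (- sl g)) * e"

lemma eact_simps [simp]:
  "eact g (ereal t) = ereal (act g t)" "eact g \<infinity> = \<infinity>" "eact g (-\<infinity>) = -\<infinity>"
  using n_pos by (simp_all add: eact_def act_def)

lemma eact_mono: "e \<le> e' \<Longrightarrow> eact g e \<le> eact g e'"
  unfolding eact_def using n_pos by (intro add_left_mono ereal_mult_left_mono) simp_all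

lemma eact_inv:
  assumes "g \<in> carrier G"
  shows "eact g (eact (inv g) e) = e"
  using assms by (cases e; simp add: act_inv)

lemma conj_set_image:
  assumes P: "P \<subseteq> carrier G" and g: "g \<in> carrier G"
  shows "conj_set g P = (\<lambda>h. g \<otimes> h \<otimes> inv g) ` P"
proof -
  have 1: "inv g \<otimes> (g \<otimes> h \<otimes> inv g) \<otimes> g = h" "g \<otimes> (inv g \<otimes> h \<otimes> g) \<otimes> inv g = h"
    if "h \<in> carrier G" for h
    using that g by (simp_all add: m_assoc) (simp_all add: m_assoc[symmetric])
  show ?thesis
  proof (intro equalityI subsetI)
    fix h assume h: "h \<in> conj_set g P"
    then have "h = g \<otimes> (inv g \<otimes> h \<otimes> g) \<otimes> inv g" using 1 by (simp add: conj_set_def)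
    then show "h \<in> (\<lambda>h. g \<otimes> h \<otimes> inv g) ` P" using h unfolding conj_set_def by blast
  qed (use P g 1 in \<open>auto simp: conj_set_def subsetD\<close>)
qed

text \<open>Conjugation by \<open>g\<close> carries fixed points to their images under \<open>g\<close>. One inequality holds for every
  \<open>g\<close>; applied to the inverse of \<open>g\<close> it gives the other.\<close>

lemma cut_conj:
  assumes P: "P \<subseteq> carrier G" and g: "g \<in> carrier G"
  shows "cut (conj_set g P) = eact g (cut P)"
proof -
  have le: "eact g (cut P) \<le> cut (conj_set g P)" if P: "P \<subseteq> carrier G" and g: "g \<in> carrier G" for g P
    unfolding cut_def[of "conj_set g P"]
  proof (rule INF_greatest)
    fix h assume "h \<in> {h \<in> conj_set g P. sl h = 1}"
    then obtain p where p: "p \<in> P" "h = g \<otimes> p \<otimes> inv g" "sl h = 1"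
      by (auto simp: conj_set_image[OF P g])
    have pc: "p \<in> carrier G" using p P by blast
    have slp: "sl p = 1" using p g pc by (simp add: sl_mult sl_inv)
    have "cut P \<le> ereal (fixp p)" unfolding cut_def by (rule INF_lower) (use p slp in simp)
    then have "eact g (cut P) \<le> eact g (ereal (fixp p))" by (rule eact_mono)
    also have "\<dots> = ereal (fixp h)" using fixp_conj[OF g pc] slp p by simp
    finally show "eact g (cut P) \<le> ereal (fixp h)" .
  qed
  have sub: "conj_set g P \<subseteq> carrier G" by (auto simp: conj_set_def)
  have "eact (inv g) (cut (conj_set g P)) \<le> cut P"
    using le[OF sub, of "inv g"] g conj_set_inv[OF P g] by simp
  from eact_mono[OF this, of g] have "cut (conj_set g P) \<le> eact g (cut P)"
    by (simp add: eact_inv[OF g])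
  then show ?thesis using le[OF P g] by (rule antisym)
qed

lemma tie_conj:
  assumes P: "P \<subseteq> carrier G" and g: "g \<in> carrier G"
  shows "tie (conj_set g P) = tie P"
proof -
  have le: "tie (conj_set g P)" if P: "P \<subseteq> carrier G" and g: "g \<in> carrier G" and t: "tie P" for g P
  proof -
    obtain h where h: "h \<in> P" "sl h > 0" "ereal (fixp h) = cut P" using t unfolding tie_def by blast
    have hc: "h \<in> carrier G" using P h by blast
    have "ereal (fixp (g \<otimes> h \<otimes> inv g)) = cut (conj_set g P)"
      using cut_conj[OF P g] h(3)[symmetric] fixp_conj[OF g hc h(2)] by simp
    moreover have "sl (g \<otimes> h \<otimes> inv g) > 0" using g hc h by (simp add: sl_mult sl_inv)
    ultimately show ?thesis unfolding tie_def conj_set_image[OF P g] using h(1) by blast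
  qed
  have sub: "conj_set g P \<subseteq> carrier G" by (auto simp: conj_set_def)
  show ?thesis using le[OF P g] le[OF sub, of "inv g"] g conj_set_inv[OF P g] by auto
qed

text \<open>Passing to the opposite order makes the shift by 1 positive, so that only one orientation of the line
  has to be treated.\<close>

definition normal_cone :: "'a set \<Rightarrow> 'a set" where
  "normal_cone P = (if shift \<in> P then P else opposite P)"

lemma normal_cone:
  assumes P: "positive_cone G P"
  shows "positive_cone G (normal_cone P)" "shift \<in> normal_cone P"
proof -
  have "shift \<noteq> \<one>" using elt(3)[of 0 1 0] tr_one by auto
  then have "shift \<notin> P \<Longrightarrow> inv shift \<in> P" using cone_total[OF P elt(1)] by blast
  then show "shift \<in> normal_cone P" by (auto simp: normal_cone_def opposite_def elt)
  show "positive_cone G (normal_cone P)" using P opposite_cone by (simp add: normal_cone_def)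
qed

text \<open>A conjugate of a translation to the right is a translation to the right.\<close>

lemma shift_conj:
  assumes P: "positive_cone G P" and g: "g \<in> carrier G"
  shows "shift \<in> conj_set g P \<longleftrightarrow> shift \<in> P"
proof -
  let ?u = "inv g \<otimes> shift \<otimes> g"
  have u: "?u \<in> carrier G" "sl ?u = 0" "tr ?u > 0"
    using g n_pos by (auto simp: sl_mult tr_mult sl_inv tr_inv elt)
  have "?u \<in> normal_cone P" using translation_in_cone[OF normal_cone[OF P] u(1,2)] u(3) by simp
  then have "?u \<in> P \<longleftrightarrow> shift \<in> P"
    using cone_asym[OF P, of ?u] by (auto simp: normal_cone_def opposite_def split: if_splits)
  then show ?thesis by (simp add: conj_set_def elt)
qed

lemma normal_cone_conj:
  assumes "positive_cone G P" "g \<in> carrier G"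
  shows "normal_cone (conj_set g P) = conj_set g (normal_cone P)"
  using assms by (simp add: normal_cone_def shift_conj conj_opposite)

lemma normal_cone_cancel:
  assumes P: "positive_cone G P" and P': "positive_cone G P'"
    and eq: "shift \<in> P \<longleftrightarrow> shift \<in> P'" "normal_cone P = normal_cone P'"
  shows "P = P'"
proof (cases "shift \<in> P")
  case True
  then show ?thesis using eq by (simp add: normal_cone_def)
next
  case False
  then have "opposite P = opposite P'" using eq by (simp add: normal_cone_def)
  moreover have "P \<subseteq> carrier G" "P' \<subseteq> carrier G" using P P' by (simp_all add: positive_cone_iff)
  ultimately show ?thesis by (metis opposite_opposite)
qed

text \<open>Equal bits and cuts in one orbit suffice: conjugating by an element that matches the cuts gives a cone
  with the same invariants, hence the same cone.\<close>

theorem conjugate_iff: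
  assumes P: "positive_cone G P" and P': "positive_cone G P'"
  defines "Q \<equiv> normal_cone P" and "Q' \<equiv> normal_cone P'"
  shows "(\<exists>g\<in>carrier G. conj_set g P = P') \<longleftrightarrow>
    (shift \<in> P \<longleftrightarrow> shift \<in> P') \<and> tie Q = tie Q' \<and> (\<exists>g\<in>carrier G. eact g (cut Q) = cut Q')"
proof
  have sub: "Q \<subseteq> carrier G"
    using cone_carrier[OF normal_cone(1)[OF P]] unfolding Q_def by blast
  {
    assume "\<exists>g\<in>carrier G. conj_set g P = P'"
    then obtain g where g: "g \<in> carrier G" "conj_set g P = P'" by blast
    then have "Q' = conj_set g Q" using normal_cone_conj[OF P g(1)] by (simp add: Q_def Q'_def)
    then show "(shift \<in> P \<longleftrightarrow> shift \<in> P') \<and> tie Q = tie Q' \<and> (\<exists>g\<in>carrier G. eact g (cut Q) = cut Q')"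
      using shift_conj[OF P g(1)] tie_conj[OF sub g(1)] cut_conj[OF sub g(1)] g by auto
  next
    assume r: "(shift \<in> P \<longleftrightarrow> shift \<in> P') \<and> tie Q = tie Q' \<and> (\<exists>g\<in>carrier G. eact g (cut Q) = cut Q')"
    then obtain g where g: "g \<in> carrier G" "eact g (cut Q) = cut Q'" by blast
    note conj_P = conj_cone[OF P g(1)]
    have Q_conj: "normal_cone (conj_set g P) = conj_set g Q"
      using normal_cone_conj[OF P g(1)] by (simp add: Q_def)
    have "conj_set g Q = Q'"
      by (rule cone_determined)
        (use normal_cone[OF conj_P] normal_cone[OF P'] r g cut_conj[OF sub g(1)] tie_conj[OF sub g(1)]
          in \<open>auto simp: Q_conj Q'_def\<close>)
    then have "conj_set g P = P'"
      using normal_cone_cancel[OF conj_P P'] shift_conj[OF P g(1)] r Q_conj by (simp add: Q'_def)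
    then show "\<exists>g\<in>carrier G. conj_set g P = P'" using g by blast
  }
qed

text \<open>The conversion from extended reals sends both infinite values to 0, so for infinite cuts the condition
  on digits holds trivially.\<close>

lemma eact_orbit:
  "(\<exists>g\<in>carrier G. eact g e = e') \<longleftrightarrow> (e = \<infinity> \<longleftrightarrow> e' = \<infinity>) \<and> (e = -\<infinity> \<longleftrightarrow> e' = -\<infinity>) \<and>
     tail_eq (digits n (real_of_ereal e)) (digits n (real_of_ereal e'))"
proof -
  have "tail_eq d d" for d :: "nat \<Rightarrow> nat" unfolding tail_eq_def by blast
  then show ?thesis
    using act_orbit one_closed by (cases e; cases e') auto
qed

definition cone_code :: "'a set \<Rightarrow> nat \<Rightarrow> (bool \<times> bool \<times> bool \<times> bool) \<times> bool \<times> nat list" where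
  "cone_code P m = (let Q = normal_cone P; e = cut Q in
     ((shift \<in> P, tie Q, e = \<infinity>, e = -\<infinity>), tail_code (digits n (real_of_ereal e)) m))"

lemma cone_code:
  assumes P: "positive_cone G P" and P': "positive_cone G P'"
  shows "(P, P') \<in> E_lo G \<longleftrightarrow> (graph_seq (cone_code P), graph_seq (cone_code P')) \<in> E0"
proof -
  have bd: "\<forall>i. digits n x i < n" for x using digits_less[OF n2] by blast
  have "(\<exists>m0. \<forall>m\<ge>m0. tail_code (digits n x) m = tail_code (digits n y) m)
      \<longleftrightarrow> tail_eq (digits n x) (digits n y)" for x y
    using tail_code_sound[OF bd bd] tail_code_complete[OF bd bd] by blast
  then show ?thesis
    unfolding graph_seq_E0 E_lo_iff conjugate_iff[OF P P'] eact_orbit cone_code_def Let_def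
    using P P' by auto
qed

end

section \<open>Reducing conjugacy of cones to eventual equality\<close>

context affine_group
begin

lemma normal_cone_mem_measurable:
  assumes g: "g \<in> carrier G"
  shows "Measurable.pred (borel_of (LO_topology G)) (\<lambda>P. g \<in> normal_cone P)"
proof -
  note LO_coordinate_measurable[OF elt(1)[of 0 1 0], measurable]
    LO_coordinate_measurable[OF g, measurable]
    LO_coordinate_measurable[OF inv_closed[OF g], measurable]
  have "(\<lambda>P. g \<in> normal_cone P) = (\<lambda>P. if shift \<in> P then g \<in> P else inv g \<in> P)"
    using g by (auto simp: normal_cone_def opposite_def fun_eq_iff)
  then show ?thesis by simp
qed

text \<open>The infimum can be taken over all contractions of slope \<open>1/n\<close>, a countable index set independent of
  \<open>P\<close>, when those outside the cone contribute \<open>\<infinity>\<close>.\<close>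

lemma cut_measurable:
  "(\<lambda>P. cut (normal_cone P)) \<in> borel_of (LO_topology G) \<rightarrow>\<^sub>M borel"
proof -
  let ?M = "borel_of (LO_topology G)" and ?H = "{h \<in> carrier G. sl h = 1}"
  have eq: "cut (normal_cone P) = (INF h\<in>?H. if h \<in> normal_cone P then ereal (fixp h) else \<infinity>)"
    if "P \<in> space ?M" for P
  proof -
    have "normal_cone P \<subseteq> carrier G"
      using that normal_cone(1)[of P] by (simp add: topspace_LO_topology LO_def positive_cone_iff)
    then have mem: "h \<in> {h \<in> normal_cone P. sl h = 1} \<longleftrightarrow> h \<in> ?H \<and> h \<in> normal_cone P" for h by blast
    show ?thesis
      unfolding cut_def
    proof (intro antisym INF_greatest)
      fix h assume "h \<in> ?H"
      then show "(INF h\<in>{h \<in> normal_cone P. sl h = 1}. ereal (fixp h))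
          \<le> (if h \<in> normal_cone P then ereal (fixp h) else \<infinity>)"
      proof (cases "h \<in> normal_cone P")
        case True
        then have "h \<in> {h \<in> normal_cone P. sl h = 1}" using mem \<open>h \<in> ?H\<close> by blast
        from INF_lower[OF this, of "\<lambda>h. ereal (fixp h)"] show ?thesis using True by simp
      qed simp
    next
      fix h assume "h \<in> {h \<in> normal_cone P. sl h = 1}"
      then have "h \<in> ?H" "h \<in> normal_cone P" using mem by blast+
      then show "(INF h\<in>?H. if h \<in> normal_cone P then ereal (fixp h) else \<infinity>) \<le> ereal (fixp h)"
        by (intro INF_lower2[of h]) simp_all
    qed
  qed
  have "countable ?H" by (rule countable_subset[OF _ countable_carrier]) auto
  then have "(\<lambda>P. INF h\<in>?H. if h \<in> normal_cone P then ereal (fixp h) else \<infinity>) \<in> ?M \<rightarrow>\<^sub>M borel"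
  proof (rule borel_measurable_INF)
    fix h assume "h \<in> ?H"
    then have "Measurable.pred ?M (\<lambda>P. h \<in> normal_cone P)" using normal_cone_mem_measurable by blast
    then show "(\<lambda>P. if h \<in> normal_cone P then ereal (fixp h) else \<infinity>) \<in> ?M \<rightarrow>\<^sub>M borel"
      by measurable
  qed
  then show ?thesis by (rule iffD2[OF measurable_cong, rotated]) (rule eq)
qed

lemma tie_measurable:
  "Measurable.pred (borel_of (LO_topology G)) (\<lambda>P. tie (normal_cone P))"
proof -
  let ?M = "borel_of (LO_topology G)" and ?H = "{h \<in> carrier G. sl h > 0}"
  have eq: "tie (normal_cone P) \<longleftrightarrow>
      (\<exists>h\<in>?H. h \<in> normal_cone P \<and> ereal (fixp h) = cut (normal_cone P))"
    if "P \<in> space ?M" for P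
  proof -
    have "normal_cone P \<subseteq> carrier G"
      using that normal_cone(1)[of P] by (simp add: topspace_LO_topology LO_def positive_cone_iff)
    then show ?thesis unfolding tie_def by blast
  qed
  have "countable ?H" by (rule countable_subset[OF _ countable_carrier]) auto
  then have "Measurable.pred ?M (\<lambda>P. \<exists>h\<in>?H. h \<in> normal_cone P \<and> ereal (fixp h) = cut (normal_cone P))"
    unfolding pred_def
  proof (rule sets.sets_Collect_countable_Ex'[rotated])
    fix h assume "h \<in> ?H"
    then have [measurable]: "Measurable.pred ?M (\<lambda>P. h \<in> normal_cone P)"
      using normal_cone_mem_measurable by blast
    note cut_measurable[measurable]
    have "Measurable.pred ?M (\<lambda>P. h \<in> normal_cone P \<and> ereal (fixp h) = cut (normal_cone P))"
      by measurable
    then show "{P \<in> space ?M. h \<in> normal_cone P \<and> ereal (fixp h) = cut (normal_cone P)} \<in> sets ?M"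
      by (simp only: pred_def)
  qed
  then show ?thesis by (rule iffD2[OF measurable_cong, rotated]) (rule eq)
qed

lemma cone_code_measurable:
  "Measurable.pred (borel_of (LO_topology G)) (\<lambda>P. cone_code P m = c)"
proof -
  let ?M = "borel_of (LO_topology G)"
  obtain b1 b2 b3 b4 w where c: "c = ((b1, b2, b3, b4), w)" by (metis surj_pair)
  have 1: "Measurable.pred ?M (\<lambda>P. (shift \<in> P) = b1)"
    using LO_coordinate_measurable[OF elt(1)[of 0 1 0]] by measurable
  have 2: "Measurable.pred ?M (\<lambda>P. tie (normal_cone P) = b2)"
    using tie_measurable by measurable
  have 3: "Measurable.pred ?M (\<lambda>P. (cut (normal_cone P) = \<infinity>) = b3)"
    using cut_measurable by measurable
  have 4: "Measurable.pred ?M (\<lambda>P. (cut (normal_cone P) = -\<infinity>) = b4)"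
    using cut_measurable by measurable
  have "(\<lambda>P. real_of_ereal (cut (normal_cone P))) \<in> ?M \<rightarrow>\<^sub>M borel"
    by (rule measurable_compose[OF cut_measurable]) measurable
  then have "(\<lambda>P. digits n (real_of_ereal (cut (normal_cone P))) i) \<in> ?M \<rightarrow>\<^sub>M count_space UNIV" for i
    by (rule measurable_compose) (rule digits_measurable)
  then have "(\<lambda>P. tail_code (digits n (real_of_ereal (cut (normal_cone P)))) m) \<in> ?M \<rightarrow>\<^sub>M count_space UNIV"
    by (rule tail_code_measurable)
  then have 5: "Measurable.pred ?M (\<lambda>P. tail_code (digits n (real_of_ereal (cut (normal_cone P)))) m = w)"
    by (rule measurable_compose) simp
  have "(\<lambda>P. cone_code P m = c) = (\<lambda>P. (shift \<in> P) = b1 \<and> tie (normal_cone P) = b2 \<and>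
      (cut (normal_cone P) = \<infinity>) = b3 \<and> (cut (normal_cone P) = -\<infinity>) = b4 \<and>
      tail_code (digits n (real_of_ereal (cut (normal_cone P)))) m = w)"
    unfolding cone_code_def Let_def c by (simp only: prod.inject conj_assoc)
  moreover have "Measurable.pred ?M (\<lambda>P. (shift \<in> P) = b1 \<and> tie (normal_cone P) = b2 \<and>
      (cut (normal_cone P) = \<infinity>) = b3 \<and> (cut (normal_cone P) = -\<infinity>) = b4 \<and>
      tail_code (digits n (real_of_ereal (cut (normal_cone P)))) m = w)"
    by (intro pred_intros_logic 1 2 3 4 5)
  ultimately show ?thesis by simp
qed

theorem E_lo_reducible_E0: "borel_reducible (LO_topology G) (E_lo G) (power_two UNIV) E0"
  unfolding borel_reducible_def
proof (intro bexI ballI)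
  show "(P, P') \<in> E_lo G \<longleftrightarrow> (graph_seq (cone_code P), graph_seq (cone_code P')) \<in> E0"
    if "P \<in> topspace (LO_topology G)" "P' \<in> topspace (LO_topology G)" for P P'
    using cone_code that by (simp add: topspace_LO_topology LO_def)
  show "(\<lambda>P. graph_seq (cone_code P)) \<in> borel_of (LO_topology G) \<rightarrow>\<^sub>M borel_of (power_two UNIV)"
  proof (rule measurable_power_two)
    fix k
    have "graph_seq (cone_code P) k \<longleftrightarrow> (\<exists>m c. cone_code P m = c \<and> k = to_nat (m, c))" for P
      unfolding graph_seq_def by (simp only: ex_simps simp_thms)
    moreover have "Measurable.pred (borel_of (LO_topology G)) (\<lambda>P. \<exists>m c. cone_code P m = c \<and> k = to_nat (m, c))"
      by (intro pred_intros_countable pred_intros_conj2' cone_code_measurable)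
    ultimately show "{P \<in> space (borel_of (LO_topology G)). graph_seq (cone_code P) k} \<in> sets (borel_of (LO_topology G))"
      unfolding pred_def by (simp only:)
  qed simp_all
qed

end

section \<open>Reducing eventual equality to conjugacy of cones\<close>

text \<open>All positions used are even, so no two digits 1 are adjacent; in base 2 this avoids the ambiguity of
  expansions that end in digits 1.\<close>

definition spread :: "(nat \<Rightarrow> bool) \<Rightarrow> nat \<Rightarrow> nat" where
  "spread x j = of_bool (\<exists>k. j = 2 ^ (2 * k + 1 + of_bool (x k)))"

definition spread_real :: "nat \<Rightarrow> (nat \<Rightarrow> bool) \<Rightarrow> real" where
  "spread_real n x = (\<Sum>j. real (spread x j) / real n ^ j)"

lemma spread_eq_one_iff: "spread x j = 1 \<longleftrightarrow> (\<exists>k. j = 2 ^ (2 * k + 1 + of_bool (x k)))"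
  unfolding spread_def by (rule of_bool_eq_1_iff)

lemma spread_odd: "odd j \<Longrightarrow> spread x j = 0"
proof (rule ccontr)
  assume j: "odd j" "spread x j \<noteq> 0"
  have "even ((2::nat) ^ (a + 1 + b))" for a b :: nat by (simp add: power_add)
  moreover obtain k where "j = 2 ^ (2 * k + 1 + of_bool (x k))"
    using j(2) unfolding spread_def of_bool_eq_0_iff by blast
  ultimately show False using j(1) by simp
qed

lemma spread_sparse: "spread x j = 0 \<or> spread x (Suc j) = 0"
  using spread_odd[of j x] spread_odd[of "Suc j" x] by (cases "even j") simp_all

lemma spread_le_one: "spread x j \<le> 1"
  by (simp add: spread_def)

lemma digits_spread_real:
  assumes n: "n \<ge> 2"
  shows "digits n (spread_real n x) j = spread x j"
proof -
  define q where "q = 1 / real n"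
  have q: "0 < q" "q \<le> 1 / 2" using n by (auto simp: q_def field_simps)
  define R where "R j = (\<Sum>i. real (spread x (i + j)) * q ^ i)" for j
  have geo: "summable (\<lambda>i. q ^ i)" using q by (intro summable_geometric) simp
  have le: "real (spread x i) * q ^ m \<le> q ^ m" for i m
    using spread_le_one[of x i] q by (intro mult_left_le_one_le) auto
  have sm: "summable (\<lambda>i. real (spread x (i + j)) * q ^ i)" for j
    by (rule summable_comparison_test'[OF geo]) (use le q in \<open>auto simp: abs_mult\<close>)
  have R0: "0 \<le> R j" for j unfolding R_def using q by (intro suminf_nonneg sm) simp
  have R2: "R j \<le> 2" for j
  proof -
    have "R j \<le> (\<Sum>i. q ^ i)" unfolding R_def by (intro suminf_le le sm geo)
    also have "\<dots> = 1 / (1 - q)" using q by (intro suminf_geometric) simp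
    also have "\<dots> \<le> 2" using q by (simp add: field_simps)
    finally show ?thesis .
  qed
  have rec: "R j = real (spread x j) + q * R (Suc j)" for j
  proof -
    have "R j = real (spread x j) + (\<Sum>i. real (spread x (Suc i + j)) * q ^ Suc i)"
      using suminf_split_head[OF sm[of j]] by (simp add: R_def)
    also have "(\<Sum>i. real (spread x (Suc i + j)) * q ^ Suc i) = (\<Sum>i. q * (real (spread x (i + Suc j)) * q ^ i))"
      by (simp add: ac_simps)
    also have "\<dots> = q * R (Suc j)" unfolding R_def by (intro suminf_mult sm)
    finally show ?thesis .
  qed
  \<comment> \<open>Two adjacent digits 1 never occur, so the digits after any position contribute less than one unit.\<close>
  have frac: "q * R j < 1" for j
  proof (cases "spread x j = 0")
    case True
    then have "R j \<le> q * 2" using rec[of j] R2[of "Suc j"] q by simp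
    then have "R j \<le> 1" using q by simp
    then have "q * R j \<le> q * 1" using q by (intro mult_left_mono) auto
    then show ?thesis using q by linarith
  next
    case False
    then have 0: "spread x (Suc j) = 0" using spread_sparse[of x j] by simp
    have "R (Suc j) \<le> q * 2" using rec[of "Suc j"] 0 R2[of "Suc (Suc j)"] q by simp
    then have "q * R (Suc j) \<le> (1 / 2) * 1" using q R0[of "Suc j"] by (intro mult_mono) auto
    then have "R j \<le> 3 / 2" using rec[of j] spread_le_one[of x j] by simp
    then have "q * R j \<le> (1 / 2) * (3 / 2)" using q R0[of j] by (intro mult_mono) auto
    then show ?thesis by simp
  qed
  define z where "z = spread_real n x"
  have z: "z = R 0" by (simp add: z_def spread_real_def R_def q_def power_divide)
  have "\<exists>N::int. real n ^ j * z = of_int (int n * N + int (spread x j)) + q * R (Suc j)" for j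
  proof (induction j)
    case 0
    show ?case using rec[of 0] by (intro exI[of _ 0]) (simp add: z)
  next
    case (Suc j)
    then obtain N :: int where N: "real n ^ j * z = of_int (int n * N + int (spread x j)) + q * R (Suc j)" by blast
    have "real n ^ Suc j * z = real n * (real n ^ j * z)" by simp
    also have "\<dots> = real n * of_int (int n * N + int (spread x j)) + R (Suc j)"
      unfolding N using n by (simp add: q_def distrib_left)
    also have "\<dots> = of_int (int n * (int n * N + int (spread x j)) + int (spread x (Suc j))) + q * R (Suc (Suc j))"
      using rec[of "Suc j"] by simp
    finally show ?case by blast
  qed
  then obtain N :: int where "real n ^ j * z = of_int (int n * N + int (spread x j)) + q * R (Suc j)" by blast
  then have "\<lfloor>real n ^ j * z\<rfloor> = int n * N + int (spread x j)"
    using frac[of "Suc j"] R0[of "Suc j"] q by (intro floor_unique) auto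
  then show ?thesis
    using spread_le_one[of x j] n by (simp add: digits_def z_def[symmetric])
qed

text \<open>A shift matches large positions \<open>2^e\<close> and \<open>2^e'\<close> that differ by a bounded amount, which forces
  \<open>e = e'\<close>; the parity of the exponent then reveals the bit.\<close>

lemma spread_tail_eq:
  "tail_eq (spread x) (spread y) \<longleftrightarrow> (x, y) \<in> E0"
proof
  assume "tail_eq (spread x) (spread y)"
  then obtain p q where pq: "\<And>i. spread x (p + i) = spread y (q + i)" unfolding tail_eq_def by blast
  have "x k = y k" if k: "k > p + q" for k
  proof -
    define e where "e = 2 * k + 1 + of_bool (x k)"
    have big: "2 ^ e > 2 * (p + q)"
    proof -
      have "2 * (p + q) < 2 * 2 ^ (p + q)" by (intro mult_strict_left_mono less_exp) simp
      also have "\<dots> = 2 ^ Suc (p + q)" by simp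
      also have "\<dots> \<le> 2 ^ e" using k by (intro power_increasing) (auto simp: e_def)
      finally show ?thesis .
    qed
    have "spread x (p + (2 ^ e - p)) = 1"
      using big by (auto simp: spread_def e_def)
    then have "spread y (q + (2 ^ e - p)) = 1" using pq by simp
    then obtain k' where k': "q + (2 ^ e - p) = 2 ^ (2 * k' + 1 + of_bool (y k'))"
      unfolding spread_eq_one_iff by blast
    define e' where "e' = 2 * k' + 1 + of_bool (y k' )"
    have eq: "2 ^ e + q = 2 ^ e' + p" using k' big by (simp add: e'_def)
    have "\<not> e < e'"
    proof
      assume "e < e'"
      then have "(2::nat) ^ Suc e \<le> 2 ^ e'" by (intro power_increasing) auto
      then show False using eq big by simp
    qed
    moreover have "\<not> e' < e"
    proof
      assume "e' < e"
      then have "(2::nat) ^ Suc e' \<le> 2 ^ e" by (intro power_increasing) auto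
      then show False using eq big by simp
    qed
    ultimately have ee: "e = e'" by simp
    then have "k = k'" unfolding e_def e'_def by (auto split: if_splits simp: of_bool_def)
    then show ?thesis using ee unfolding e_def e'_def by (auto split: if_splits simp: of_bool_def)
  qed
  then show "(x, y) \<in> E0" unfolding E0_def by blast
next
  assume "(x, y) \<in> E0"
  then obtain m where m: "\<And>k. k > m \<Longrightarrow> x k = y k" unfolding E0_def by blast
  define b :: nat where "b = 2 ^ (2 * m + 3)"
  have sub: "\<exists>k. b + i = 2 ^ (2 * k + 1 + of_bool (v k))"
    if uv: "\<And>k. k > m \<Longrightarrow> u k = v k" and ex: "\<exists>k. b + i = 2 ^ (2 * k + 1 + of_bool (u k))"
    for u v :: "nat \<Rightarrow> bool" and i
  proof -
    obtain k where k: "b + i = 2 ^ (2 * k + 1 + of_bool (u k))" using ex by blast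
    have "(2::nat) ^ (2 * m + 3) \<le> 2 ^ (2 * k + 1 + of_bool (u k))" unfolding k[symmetric] b_def by simp
    then have "2 * m + 3 \<le> 2 * k + 1 + of_bool (u k)" by (simp only: power_increasing_iff)
    then have "k > m" by (cases "u k") auto
    then have "u k = v k" by (rule uv)
    then have "b + i = 2 ^ (2 * k + 1 + of_bool (v k))" using k by (simp only:)
    then show ?thesis by (rule exI)
  qed
  have "spread x (b + i) = spread y (b + i)" for i
  proof -
    have "(\<exists>k. b + i = 2 ^ (2 * k + 1 + of_bool (x k))) \<longleftrightarrow> (\<exists>k. b + i = 2 ^ (2 * k + 1 + of_bool (y k)))"
      by (rule iffI; erule sub[rotated]; rule m[symmetric] m; assumption)
    then show ?thesis by (simp only: spread_def)
  qed
  then show "tail_eq (spread x) (spread y)" unfolding tail_eq_def by blast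
qed

lemma spread_real_measurable: "spread_real n \<in> borel_of (power_two UNIV) \<rightarrow>\<^sub>M borel"
proof -
  note power_two_coordinate_measurable[OF UNIV_I, measurable]
  have "Measurable.pred (borel_of (power_two UNIV)) (\<lambda>x. j = 2 ^ (2 * k + 1 + of_bool (x k)))" for j k :: nat
  proof -
    have "(\<lambda>x. j = 2 ^ (2 * k + 1 + of_bool (x k))) =
        (\<lambda>x. if x k then j = 2 ^ (2 * k + 2) else j = 2 ^ (2 * k + 1))"
      by auto
    then show ?thesis by simp
  qed
  then have "Measurable.pred (borel_of (power_two UNIV)) (\<lambda>x. \<exists>k. j = 2 ^ (2 * k + 1 + of_bool (x k)))" for j :: nat
    by (rule pred_intros_countable)
  from measurable_compose[OF this, of "\<lambda>b. real (of_bool b)" borel for j]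
  have "(\<lambda>x. real (spread x j)) \<in> borel_measurable (borel_of (power_two UNIV))" for j
    unfolding spread_def by simp
  then show ?thesis
    unfolding spread_real_def[abs_def] by (intro borel_measurable_suminf borel_measurable_divide) auto
qed

context affine_group
begin

text \<open>Ties at \<open>t\<close> are broken by the slope, so that every real \<open>t\<close>, also one with a nontrivial stabiliser,
  yields a total order.\<close>

definition point_cone :: "real \<Rightarrow> 'a set" where
  "point_cone t = {g \<in> carrier G. act g t > t \<or> act g t = t \<and> sl g > 0}"

lemma point_cone: "positive_cone G (point_cone t)"
  unfolding positive_cone_iff
proof (intro conjI ballI)
  have inv_less: "act (inv g) t < t \<longleftrightarrow> t < act g t" "act (inv g) t = t \<longleftrightarrow> t = act g t"
    "t < act (inv g) t \<longleftrightarrow> act g t < t"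
    if "g \<in> carrier G" for g
    using act_less_iff[of g "act (inv g) t" t] act_eq_iff[of g "act (inv g) t" t]
      act_less_iff[of g t "act (inv g) t"] act_inv(2)[OF that] by auto
  show "point_cone t \<subseteq> carrier G" by (auto simp: point_cone_def)
  show "inv g \<notin> point_cone t" if "g \<in> point_cone t" for g
    using that inv_less[of g] by (auto simp: point_cone_def sl_inv)
  show "g \<otimes> h \<in> point_cone t" if gh: "g \<in> point_cone t" "h \<in> point_cone t" for g h
  proof -
    have c: "g \<in> carrier G" "h \<in> carrier G" using gh by (auto simp: point_cone_def)
    have "act g t \<le> act g (act h t)" using gh act_less_iff[of g t "act h t"] by (auto simp: point_cone_def)
    then show ?thesis
      using gh c act_less_iff[of g t "act h t"]
      by (auto simp: point_cone_def act_mult sl_mult)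
  qed
  show "g \<in> point_cone t \<or> inv g \<in> point_cone t \<or> g = \<one>" if g: "g \<in> carrier G" for g
  proof -
    have "g = \<one>" if "act g t = t" "sl g = 0"
      using that rep_inj[OF g one_closed] by (simp add: act_def sl_one tr_one)
    then show ?thesis
      using inv_less[OF g] g
      by (cases "sl g" "0::int" rule: linorder_cases) (auto simp: point_cone_def sl_inv)
  qed
qed

lemma point_cone_conj:
  assumes g: "g \<in> carrier G"
  shows "conj_set g (point_cone t) = point_cone (act g t)"
proof -
  have "act (inv g \<otimes> h \<otimes> g) t = act (inv g) (act h (act g t))" if "h \<in> carrier G" for h
    using g that by (simp add: act_mult)
  moreover have "act (inv g) s = t \<longleftrightarrow> s = act g t" "t < act (inv g) s \<longleftrightarrow> act g t < s" for s
    using act_eq_iff[of g "act (inv g) s" t] act_less_iff[of g t "act (inv g) s"] act_inv(2)[OF g] by auto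
  ultimately show ?thesis
    using g by (auto simp: conj_set_def point_cone_def sl_mult sl_inv)
qed

text \<open>A contraction whose fixed point lies strictly between two reals moves them in opposite directions.\<close>

lemma point_cone_inj:
  assumes "point_cone s = point_cone t"
  shows "s = t"
proof -
  have "\<not> s < t" if "point_cone s = point_cone t" for s t
  proof
    assume "s < t"
    then obtain h where h: "h \<in> carrier G" "sl h = 1" "s < fixp h" "fixp h < t"
      using fixp_dense by blast
    then have "h \<in> point_cone s" "h \<notin> point_cone t"
      using act_greater_iff[of h s] act_less_self_iff[of h t] by (auto simp: point_cone_def)
    then show False using that by blast
  qed
  from this[of s t] this[of t s] show ?thesis using assms by auto
qed

lemma E_lo_point_cone:
  "(point_cone s, point_cone t) \<in> E_lo G \<longleftrightarrow> tail_eq (digits n s) (digits n t)"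
  unfolding E_lo_iff act_orbit[symmetric]
  using point_cone point_cone_conj point_cone_inj by metis

theorem E0_reducible_E_lo: "borel_reducible (power_two UNIV) E0 (LO_topology G) (E_lo G)"
  unfolding borel_reducible_def
proof (intro bexI ballI)
  let ?f = "\<lambda>x. point_cone (spread_real n x)"
  show "(x, y) \<in> E0 \<longleftrightarrow> (?f x, ?f y) \<in> E_lo G" for x y
    unfolding E_lo_point_cone using spread_tail_eq[of x y]
    by (simp add: digits_spread_real[OF n2, abs_def])
  show "?f \<in> borel_of (power_two UNIV) \<rightarrow>\<^sub>M borel_of (LO_topology G)"
  proof (rule measurable_LO_topology[OF countable_carrier])
    fix g assume g: "g \<in> carrier G"
    have "{t. g \<in> point_cone t} = {t. t < act g t} \<union> ({t. act g t = t} \<inter> {t. sl g > 0})"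
      using g by (auto simp: point_cone_def)
    also have "\<dots> \<in> sets borel" unfolding act_def by measurable
    finally have "Measurable.pred borel (\<lambda>t. g \<in> point_cone t)" by (simp add: pred_def)
    from measurable_compose[OF spread_real_measurable this]
    show "{x \<in> space (borel_of (power_two UNIV)). g \<in> ?f x} \<in> sets (borel_of (power_two UNIV))"
      unfolding pred_def .
  qed (simp add: LO_def point_cone)
qed

end

section \<open>Baumslag-Solitar groups as affine groups\<close>

lemma (in group) power_conj:
  assumes ab: "a \<in> carrier G" "b \<in> carrier G" and rel: "inv b \<otimes> a \<otimes> b = a [^] (n::nat)"
  shows "inv b \<otimes> a [^] (m::int) \<otimes> b = a [^] (int n * m)"
proof -
  have nat: "inv b \<otimes> a [^] k \<otimes> b = a [^] (n * k)" for k :: nat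
  proof (induction k)
    case (Suc k)
    have "inv b \<otimes> a [^] Suc k \<otimes> b = (inv b \<otimes> a [^] k \<otimes> b) \<otimes> (inv b \<otimes> a \<otimes> b)"
      using ab by (simp add: m_assoc) (simp add: m_assoc[symmetric])
    also have "\<dots> = a [^] (n * Suc k)"
      unfolding Suc rel using ab by (simp add: nat_pow_mult add.commute)
    finally show ?case .
  qed (use ab in simp)
  show ?thesis
  proof (cases "m \<ge> 0")
    case True
    then obtain k where "m = int k" by (metis nonneg_int_cases)
    then show ?thesis using nat[of k] by (simp flip: of_nat_mult add: int_pow_int)
  next
    case False
    then obtain k where m: "m = - int k" by (metis int_cases2 neg_0_le_iff_le of_nat_0_le_iff)
    have "inv b \<otimes> inv (a [^] k) \<otimes> b = inv (inv b \<otimes> a [^] k \<otimes> b)"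
      using ab by (simp add: inv_mult_group m_assoc)
    then show ?thesis
      using nat[of k] ab unfolding m by (simp flip: of_nat_mult add: int_pow_neg int_pow_int)
  qed
qed

abbreviation bs_rel :: "nat \<Rightarrow> (bs_gen word \<times> bs_gen word) set" where
  "bs_rel n \<equiv> {([(Gen_b, False), (Gen_a, True), (Gen_b, True)], replicate n (Gen_a, True))}"

fun letter_sl :: "bs_gen \<times> bool \<Rightarrow> int" where
  "letter_sl (Gen_a, e) = 0"
| "letter_sl (Gen_b, e) = (if e then 1 else - 1)"

fun letter_tr :: "bs_gen \<times> bool \<Rightarrow> real" where
  "letter_tr (Gen_a, e) = (if e then 1 else - 1)"
| "letter_tr (Gen_b, e) = 0"

primrec word_sl :: "bs_gen word \<Rightarrow> int" where
  "word_sl [] = 0"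
| "word_sl (l # w) = letter_sl l + word_sl w"

primrec word_tr :: "nat \<Rightarrow> bs_gen word \<Rightarrow> real" where
  "word_tr n [] = 0"
| "word_tr n (l # w) = letter_tr l + real n powi (- letter_sl l) * word_tr n w"

lemma word_sl_append: "word_sl (u @ v) = word_sl u + word_sl v"
  by (induction u) auto

lemma word_tr_append:
  assumes "n \<ge> 2"
  shows "word_tr n (u @ v) = word_tr n u + real n powi (- word_sl u) * word_tr n v"
proof (induction u)
  case (Cons l u)
  then show ?case
    using assms power_int_add[of "real n" "- letter_sl l" "- word_sl u"]
    by (simp add: algebra_simps)
qed simp

text \<open>The affine map of a word respects the defining relation: \<open>b^(-1) a b\<close> is the translation by \<open>n\<close>.\<close>

lemma word_invariant:
  assumes n: "n \<ge> 2" and "pres_eq (bs_rel n) u v"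
  shows "word_sl u = word_sl v \<and> word_tr n u = word_tr n v"
  using assms(2)
proof (induction rule: pres_eq.induct)
  case (cancel u s e v)
  have "word_sl [(s, e), (s, \<not> e)] = 0" "word_tr n [(s, e), (s, \<not> e)] = 0"
    by (cases s; simp)+
  then show ?case
    using n by (simp add: word_sl_append word_tr_append del: word_sl.simps word_tr.simps append_Cons append_Nil)
next
  case (rel l r u v)
  have "word_sl (replicate k (Gen_a, True)) = 0" "word_tr n (replicate k (Gen_a, True)) = real k" for k
    by (induction k) auto
  then have "word_sl l = word_sl r" "word_tr n l = word_tr n r"
    using rel by auto
  then show ?case using n by (simp add: word_sl_append word_tr_append)
qed auto

definition bs_sl :: "bs_gen word set \<Rightarrow> int" where
  "bs_sl X = word_sl (SOME w. w \<in> X)"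

definition bs_tr :: "nat \<Rightarrow> bs_gen word set \<Rightarrow> real" where
  "bs_tr n X = word_tr n (SOME w. w \<in> X)"

lemma bs_class:
  assumes n: "n \<ge> 2"
  shows "bs_sl (pres_class (bs_rel n) w) = word_sl w" "bs_tr n (pres_class (bs_rel n) w) = word_tr n w"
proof -
  have "w \<in> pres_class (bs_rel n) w" by (simp add: pres_class_def pres_eq.refl)
  then have "(SOME v. v \<in> pres_class (bs_rel n) w) \<in> pres_class (bs_rel n) w" by (rule someI)
  then have "pres_eq (bs_rel n) w (SOME v. v \<in> pres_class (bs_rel n) w)"
    by (simp only: pres_class_def mem_Collect_eq)
  from word_invariant[OF n this]
  show "bs_sl (pres_class (bs_rel n) w) = word_sl w" "bs_tr n (pres_class (bs_rel n) w) = word_tr n w"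
    unfolding bs_sl_def bs_tr_def by auto
qed

lemma BS1_carrier: "carrier (BS1 n) = range (pres_class (bs_rel n))"
  by (simp add: BS1_def presented_group_def)

lemma BS1_mult: "pres_class (bs_rel n) v \<otimes>\<^bsub>BS1 n\<^esub> pres_class (bs_rel n) w = pres_class (bs_rel n) (v @ w)"
  unfolding BS1_def by (rule presented_group_mult)

lemma BS1_one: "\<one>\<^bsub>BS1 n\<^esub> = pres_class (bs_rel n) []"
  by (simp add: BS1_def presented_group_def)

lemma BS1_affine_rep:
  assumes n: "n \<ge> 2"
  shows "affine_rep (BS1 n) n bs_sl (bs_tr n)"
proof -
  interpret group "BS1 n" unfolding BS1_def by (rule group_presented_group)
  show ?thesis
  proof
    show "n \<ge> 2" by (rule n)
    fix x y assume "x \<in> carrier (BS1 n)" "y \<in> carrier (BS1 n)"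
    then obtain v w where "x = pres_class (bs_rel n) v" "y = pres_class (bs_rel n) w"
      unfolding BS1_carrier by blast
    then show "bs_sl (x \<otimes>\<^bsub>BS1 n\<^esub> y) = bs_sl x + bs_sl y"
      "bs_tr n (x \<otimes>\<^bsub>BS1 n\<^esub> y) = bs_tr n x + real n powi (- bs_sl x) * bs_tr n y"
      using n by (simp_all add: BS1_mult bs_class word_sl_append word_tr_append)
  qed
qed

text \<open>The relation in the forms \<open>a b = b a^n\<close> and \<open>b^(-1) a = a^n b^(-1)\<close> moves positive powers of \<open>b\<close> to the
  left and negative ones to the right, which gives the normal form \<open>b^i a^m b^(-j)\<close> with \<open>i, j \<ge> 0\<close>. Its slope
  is \<open>i - j\<close> and its translation part \<open>m / n^i\<close>, so it is trivial only for \<open>i = j\<close> and \<open>m = 0\<close>.\<close>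

theorem BS1_affine_group:
  assumes n: "n \<ge> 2"
  shows "affine_group (BS1 n) n bs_sl (bs_tr n)"
proof -
  interpret affine_rep "BS1 n" n bs_sl "bs_tr n" by (rule BS1_affine_rep[OF n])
  let ?G = "BS1 n"
  define cl where "cl = pres_class (bs_rel n)"
  have mult: "cl v \<otimes>\<^bsub>?G\<^esub> cl w = cl (v @ w)" for v w
    unfolding cl_def by (rule BS1_mult)
  have carrier: "carrier ?G = range cl" unfolding cl_def by (rule BS1_carrier)
  have one: "\<one>\<^bsub>?G\<^esub> = cl []" unfolding cl_def by (rule BS1_one)
  define a b where "a = cl [(Gen_a, True)]" and "b = cl [(Gen_b, True)]"
  have ab: "a \<in> carrier ?G" "b \<in> carrier ?G" by (auto simp: a_def b_def carrier)
  have inv_letter: "inv\<^bsub>?G\<^esub> (cl [(s, True)]) = cl [(s, False)]" for s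
  proof (rule inv_equality)
    have "pres_eq (bs_rel n) [(s, False), (s, True)] []"
      using pres_eq.cancel[of "bs_rel n" "[]" s False "[]"] by simp
    then show "cl [(s, False)] \<otimes>\<^bsub>?G\<^esub> cl [(s, True)] = \<one>\<^bsub>?G\<^esub>"
      by (simp add: mult one) (simp add: cl_def pres_class_eq_iff)
  qed (auto simp: carrier)
  have pow_a: "a [^]\<^bsub>?G\<^esub> k = cl (replicate k (Gen_a, True))" for k :: nat
    by (induction k) (simp_all add: one mult a_def replicate_append_same)
  have rel: "inv\<^bsub>?G\<^esub> b \<otimes>\<^bsub>?G\<^esub> a \<otimes>\<^bsub>?G\<^esub> b = a [^]\<^bsub>?G\<^esub> n"
  proof -
    have "pres_eq (bs_rel n) [(Gen_b, False), (Gen_a, True), (Gen_b, True)] (replicate n (Gen_a, True))"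
      using pres_eq.rel[of _ _ "bs_rel n" "[]" "[]"] by simp
    moreover have "inv\<^bsub>?G\<^esub> b \<otimes>\<^bsub>?G\<^esub> a \<otimes>\<^bsub>?G\<^esub> b = cl [(Gen_b, False), (Gen_a, True), (Gen_b, True)]"
      unfolding b_def inv_letter a_def mult by simp
    ultimately show ?thesis
      unfolding pow_a by (simp add: cl_def pres_class_eq_iff)
  qed
  note conj = power_conj[OF ab rel]
  define nf where "nf i m j = b [^]\<^bsub>?G\<^esub> (i::nat) \<otimes>\<^bsub>?G\<^esub> a [^]\<^bsub>?G\<^esub> (m::int) \<otimes>\<^bsub>?G\<^esub> (inv\<^bsub>?G\<^esub> b) [^]\<^bsub>?G\<^esub> (j::nat)" for i m j
  have push_b: "a [^]\<^bsub>?G\<^esub> m \<otimes>\<^bsub>?G\<^esub> b = b \<otimes>\<^bsub>?G\<^esub> a [^]\<^bsub>?G\<^esub> (int n * m)" for m :: int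
    unfolding conj[of m, symmetric] using ab by (simp add: m_assoc[symmetric])
  have push_inv: "inv\<^bsub>?G\<^esub> b \<otimes>\<^bsub>?G\<^esub> a [^]\<^bsub>?G\<^esub> m = a [^]\<^bsub>?G\<^esub> (int n * m) \<otimes>\<^bsub>?G\<^esub> inv\<^bsub>?G\<^esub> b" for m :: int
    unfolding conj[of m, symmetric] using ab by (simp add: m_assoc)
  have push_pow: "a [^]\<^bsub>?G\<^esub> m \<otimes>\<^bsub>?G\<^esub> b [^]\<^bsub>?G\<^esub> i = b [^]\<^bsub>?G\<^esub> i \<otimes>\<^bsub>?G\<^esub> a [^]\<^bsub>?G\<^esub> (int n ^ i * m)"
    for m :: int and i :: nat
  proof (induction i)
    case (Suc i)
    have "a [^]\<^bsub>?G\<^esub> m \<otimes>\<^bsub>?G\<^esub> b [^]\<^bsub>?G\<^esub> Suc i = (a [^]\<^bsub>?G\<^esub> m \<otimes>\<^bsub>?G\<^esub> b [^]\<^bsub>?G\<^esub> i) \<otimes>\<^bsub>?G\<^esub> b"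
      using ab by (simp add: m_assoc)
    also have "\<dots> = b [^]\<^bsub>?G\<^esub> i \<otimes>\<^bsub>?G\<^esub> (a [^]\<^bsub>?G\<^esub> (int n ^ i * m) \<otimes>\<^bsub>?G\<^esub> b)"
      unfolding Suc using ab by (simp add: m_assoc)
    also have "\<dots> = b [^]\<^bsub>?G\<^esub> Suc i \<otimes>\<^bsub>?G\<^esub> a [^]\<^bsub>?G\<^esub> (int n ^ Suc i * m)"
      unfolding push_b using ab by (simp add: m_assoc mult.assoc)
    finally show ?case .
  qed (use ab in simp)
  have left_a: "a [^]\<^bsub>?G\<^esub> k \<otimes>\<^bsub>?G\<^esub> nf i m j = nf i (int n ^ i * k + m) j" for k i m j
  proof -
    have "a [^]\<^bsub>?G\<^esub> k \<otimes>\<^bsub>?G\<^esub> nf i m j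
        = (a [^]\<^bsub>?G\<^esub> k \<otimes>\<^bsub>?G\<^esub> b [^]\<^bsub>?G\<^esub> i) \<otimes>\<^bsub>?G\<^esub> a [^]\<^bsub>?G\<^esub> m \<otimes>\<^bsub>?G\<^esub> (inv\<^bsub>?G\<^esub> b) [^]\<^bsub>?G\<^esub> j"
      using ab by (simp add: nf_def m_assoc)
    then show ?thesis
      unfolding push_pow using ab by (simp add: nf_def m_assoc int_pow_mult)
  qed
  have left_b: "b \<otimes>\<^bsub>?G\<^esub> nf i m j = nf (Suc i) m j" for i m j
    using ab nat_pow_Suc2[of b i] by (simp add: nf_def m_assoc del: nat_pow_Suc)
  have left_inv: "inv\<^bsub>?G\<^esub> b \<otimes>\<^bsub>?G\<^esub> nf (Suc i) m j = nf i m j" for i m j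
    unfolding left_b[symmetric] using ab by (simp add: nf_def m_assoc[symmetric])
  have left_inv0: "inv\<^bsub>?G\<^esub> b \<otimes>\<^bsub>?G\<^esub> nf 0 m j = nf 0 (int n * m) (Suc j)" for m j
  proof -
    have "inv\<^bsub>?G\<^esub> b \<otimes>\<^bsub>?G\<^esub> nf 0 m j = (inv\<^bsub>?G\<^esub> b \<otimes>\<^bsub>?G\<^esub> a [^]\<^bsub>?G\<^esub> m) \<otimes>\<^bsub>?G\<^esub> (inv\<^bsub>?G\<^esub> b) [^]\<^bsub>?G\<^esub> j"
      using ab by (simp add: nf_def m_assoc)
    then show ?thesis
      unfolding push_inv using ab nat_pow_Suc2[of "inv\<^bsub>?G\<^esub> b" j]
      by (simp add: nf_def m_assoc del: nat_pow_Suc)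
  qed
  have normal_form: "\<exists>i m j. x = nf i m j" if x: "x \<in> carrier ?G" for x
  proof -
    have "\<exists>i m j. cl w = nf i m j" for w
    proof (induction w)
      case Nil
      have "cl [] = nf 0 0 0" unfolding nf_def using ab by (simp add: one[symmetric])
      then show ?case by blast
    next
      case (Cons l w)
      then obtain i m j where w: "cl w = nf i m j" by blast
      obtain s e where l: "l = (s, e)" by (cases l)
      have "cl (l # w) = cl [(s, e)] \<otimes>\<^bsub>?G\<^esub> nf i m j" unfolding l w[symmetric] mult by simp
      moreover have "\<exists>i' m' j'. cl [(s, e)] \<otimes>\<^bsub>?G\<^esub> nf i m j = nf i' m' j'"
      proof (cases s)
        case Gen_a
        have "cl [(Gen_a, e)] = a [^]\<^bsub>?G\<^esub> (if e then 1 else - 1 :: int)"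
          using ab inv_letter[of Gen_a] by (simp add: int_pow_neg a_def[symmetric])
        then show ?thesis unfolding Gen_a using left_a by metis
      next
        case Gen_b
        show ?thesis
        proof (cases e)
          case True
          then show ?thesis unfolding Gen_b using left_b[of i m j] by (auto simp: b_def[symmetric])
        next
          case False
          then have "cl [(s, e)] = inv\<^bsub>?G\<^esub> b" unfolding Gen_b b_def inv_letter by simp
          then show ?thesis using left_inv left_inv0 by (cases i) metis+
        qed
      qed
      ultimately show ?case by metis
    qed
    then show ?thesis using x unfolding carrier by blast
  qed
  have base: "bs_sl a = 0" "bs_tr n a = 1" "bs_sl b = 1" "bs_tr n b = 0"
    using bs_class[OF n] by (simp_all add: a_def b_def cl_def)
  have pow0: "bs_tr n (x [^]\<^bsub>?G\<^esub> k) = 0" if "x \<in> carrier ?G" "bs_tr n x = 0" for x and k :: nat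
    by (induction k) (use that in \<open>simp_all add: tr_one tr_mult\<close>)
  have a_int: "bs_sl (a [^]\<^bsub>?G\<^esub> m) = 0" "bs_tr n (a [^]\<^bsub>?G\<^esub> m) = of_int m" for m :: int
  proof -
    have "bs_sl (a [^]\<^bsub>?G\<^esub> m) = 0 \<and> bs_tr n (a [^]\<^bsub>?G\<^esub> m) = of_int m"
      by (cases m rule: int_cases2)
        (use ab base in \<open>simp_all add: int_pow_neg int_pow_int sl_inv tr_inv sl_pow tr_pow\<close>)
    then show "bs_sl (a [^]\<^bsub>?G\<^esub> m) = 0" "bs_tr n (a [^]\<^bsub>?G\<^esub> m) = of_int m" by auto
  qed
  have nf: "nf i m j \<in> carrier ?G" "bs_sl (nf i m j) = int i - int j" "bs_tr n (nf i m j) = of_int m / real n ^ i"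
    for i m j
  proof -
    show "nf i m j \<in> carrier ?G" using ab by (simp add: nf_def)
    show "bs_sl (nf i m j) = int i - int j"
      using ab by (simp add: nf_def sl_mult sl_pow sl_inv base a_int)
    show "bs_tr n (nf i m j) = of_int m / real n ^ i"
      using ab pow0[of b i] pow0[of "inv\<^bsub>?G\<^esub> b" j]
      by (simp add: nf_def tr_mult sl_mult sl_pow tr_inv base a_int power_int_minus field_simps)
  qed
  show ?thesis
  proof
    fix x y assume xy: "x \<in> carrier ?G" "y \<in> carrier ?G" "bs_sl x = bs_sl y" "bs_tr n x = bs_tr n y"
    let ?z = "x \<otimes>\<^bsub>?G\<^esub> inv\<^bsub>?G\<^esub> y"
    have z: "bs_sl ?z = 0" "bs_tr n ?z = 0"
      using xy n_pos by (simp_all add: sl_mult tr_mult sl_inv tr_inv power_int_minus)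
    obtain i m j where zn: "?z = nf i m j" using normal_form[of ?z] xy by blast
    then have "i = j" "m = 0" using z nf n_pos by auto
    then have "?z = \<one>\<^bsub>?G\<^esub>" unfolding zn using ab by (simp add: nf_def nat_pow_inv)
    then show "x = y" using xy by (metis inv_equality inv_inv inv_closed)
  next
    fix x assume "x \<in> carrier ?G"
    then show "\<exists>(m::int) j. bs_tr n x = of_int m / real n ^ j" using normal_form nf by metis
  next
    fix k m :: int and j :: nat
    define p q where "p = nat k" and "q = nat (- k)"
    have k: "k = int p - int q" by (simp add: p_def q_def)
    have "bs_sl (nf j m j \<otimes>\<^bsub>?G\<^esub> nf p 0 q) = k \<and> bs_tr n (nf j m j \<otimes>\<^bsub>?G\<^esub> nf p 0 q) = of_int m / real n ^ j"
      using nf by (simp add: sl_mult tr_mult k)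
    then show "\<exists>x\<in>carrier ?G. bs_sl x = k \<and> bs_tr n x = of_int m / real n ^ j"
      using nf(1) m_closed by blast
  qed
qed

theorem mainTheorem2:
  fixes n :: nat
  assumes "n \<ge> 2"
  shows "borel_reducible (LO_topology (BS1 n)) (E_lo (BS1 n)) (power_two UNIV) E0 \<and>
         borel_reducible (power_two UNIV) E0 (LO_topology (BS1 n)) (E_lo (BS1 n))"
proof -
  interpret affine_group "BS1 n" n bs_sl "bs_tr n"
    by (rule BS1_affine_group[OF assms])
  show ?thesis
    using E_lo_reducible_E0 E0_reducible_E_lo by blast
qed

end
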